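(* For any $n\ge 1$ and $k\ge 0$, the Tamari lattice $\operatorname{Tam}_n$ and the Dyck lattice $\operatorname{Dyck}_n$ have the same number of linear intervals of height $k$.
   Context: Intervals. In a finite poset, for $P\le Q$ the interval $[P,Q]$ is the set of $R$ with $P\le R\le Q$. Its height is the maximal length $k$ of a chain $P=P_0<P_1<\dots<P_k=Q$. It is linear if it is totally ordered. Tamari lattice. A tree is a planar rooted binary tree; its size is its number of (internal) nodes, each node having a left and a right son (each a node or a leaf). $\operatorname{Tam}_n$ is the set of trees of size $n$ ordered by the reflexive transitive closure of left rotations, where a left rotation at a node replaces, somewhere in the tree, a subtree of the form $(B,(C,D))$ by $((B,C),D)$ (here $(X,Y)$ denotes the tree whose root node has left subtree $X$ and right subtree $Y$, and $B,C,D$ are trees, possibly reduced to a leaf); the rotated tree is the larger one. Dyck lattice. A Dyck path of size $n$ is a word with $n$ letters $u$ (up steps) and $n$ letters $d$ (down steps) such that every prefix contains at least as many $u$ as $d$. The height of a step is the number of $u$ preceding it minus the number of $d$ preceding it. $\operatorname{Dyck}_n$ is the set of Dyck paths of size $n$ with $P\le Q$ if and only if for every $1\le k\le 2n$ the height of the $k$-th step of $P$ is at most that of the $k$-th step of $Q$. *)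

theory Defs
  imports Main "HOL-Library.Tree"
begin

text \<open>A poset is given by a carrier \<open>A\<close> and an order predicate \<open>le\<close> that is only
  meaningful on \<open>A\<close>.\<close>

definition interval :: "'a set \<Rightarrow> ('a \<Rightarrow> 'a \<Rightarrow> bool) \<Rightarrow> 'a \<Rightarrow> 'a \<Rightarrow> 'a set" where
  "interval A le P Q = {R \<in> A. le P R \<and> le R Q}"

definition chain_between ::
  "'a set \<Rightarrow> ('a \<Rightarrow> 'a \<Rightarrow> bool) \<Rightarrow> 'a \<Rightarrow> 'a \<Rightarrow> nat \<Rightarrow> (nat \<Rightarrow> 'a) \<Rightarrow> bool" where
  "chain_between A le P Q k c \<longleftrightarrow>
     c 0 = P \<and> c k = Q \<and> (\<forall>i\<le>k. c i \<in> A) \<and> (\<forall>i<k. le (c i) (c (Suc i)) \<and> c i \<noteq> c (Suc i))"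

text \<open>In a finite poset with \<open>P \<le> Q\<close> the set of chain lengths is finite and nonempty,
  so \<^const>\<open>Max\<close> is meaningful.\<close>

definition interval_height :: "'a set \<Rightarrow> ('a \<Rightarrow> 'a \<Rightarrow> bool) \<Rightarrow> 'a \<Rightarrow> 'a \<Rightarrow> nat" where
  "interval_height A le P Q = Max {k. \<exists>c. chain_between A le P Q k c}"

definition linear_intervals :: "'a set \<Rightarrow> ('a \<Rightarrow> 'a \<Rightarrow> bool) \<Rightarrow> nat \<Rightarrow> 'a set set" where
  "linear_intervals A le k =
     {interval A le P Q | P Q. P \<in> A \<and> Q \<in> A \<and> le P Q \<and>
        totalp_on (interval A le P Q) le \<and> interval_height A le P Q = k}"

text \<open>Planar rooted binary trees are trees with trivial node labels; \<^const>\<open>size\<close> counts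
  the internal nodes.\<close>

definition Tam :: "nat \<Rightarrow> unit tree set" where
  "Tam n = {t. size t = n}"

inductive left_rotation :: "unit tree \<Rightarrow> unit tree \<Rightarrow> bool" where
  root: "left_rotation (Node B () (Node C () D)) (Node (Node B () C) () D)"
| left: "left_rotation s t \<Longrightarrow> left_rotation (Node s () r) (Node t () r)"
| right: "left_rotation s t \<Longrightarrow> left_rotation (Node l () s) (Node l () t)"

definition tamari_le :: "unit tree \<Rightarrow> unit tree \<Rightarrow> bool" where
  "tamari_le = left_rotation\<^sup>*\<^sup>*"

datatype step = Up | Down

definition Dyck :: "nat \<Rightarrow> step list set" where
  "Dyck n = {w. count_list w Up = n \<and> count_list w Down = n \<and>
     (\<forall>m\<le>length w. count_list (take m w) Down \<le> count_list (take m w) Up)}"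

text \<open>Steps are numbered from 1: the \<open>k\<close>-th step is preceded by \<open>k - 1\<close> letters.\<close>

definition step_height :: "step list \<Rightarrow> nat \<Rightarrow> int" where
  "step_height w k =
     int (count_list (take (k - 1) w) Up) - int (count_list (take (k - 1) w) Down)"

definition dyck_le :: "nat \<Rightarrow> step list \<Rightarrow> step list \<Rightarrow> bool" where
  "dyck_le n P Q \<longleftrightarrow> (\<forall>k\<in>{1..2 * n}. step_height P k \<le> step_height Q k)"

end

theory Submission
  imports Defs
begin

text \<open>Both lattices are generated by elementary moves carrying two labels. Number the nodes of a
  tree in inorder; the rotation of \<open>(B, (C, D))\<close> into \<open>((B, C), D)\<close> has as labels the number
  \<open>x\<close> of the node rotated and the number \<open>y\<close> of its right son. In a Dyck path, the move of a
  valley \<open>du\<close> to a peak \<open>ud\<close> has as labels the index \<open>x\<close> of the letter \<open>d\<close> among the down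
  steps and the index \<open>y\<close> of the letter \<open>u\<close> among the up steps. In both cases an interval of
  height \<open>k > 0\<close> is linear if and only if it is spanned by \<open>k\<close> successive moves with the same
  \<open>x\<close>, or by \<open>k\<close> successive moves with the same \<open>y\<close>.

  A chain of moves with constant \<open>x\<close> spans a linear interval because some vector of numbers
  attached to the elements decreases along the order, and a move changes only its \<open>x\<close>-th entry:
  an element of the interval can be reached by moves with label \<open>x\<close> only, and a start and a label
  determine the move. The case of constant \<open>y\<close> follows from a symmetry that exchanges the two
  labels: mirroring trees, which reverses the order, and reflecting paths, which preserves it.
  Conversely, if both labels change in two successive moves, or first one and then the other label
  changes in three successive moves, then either the moves are impossible or another move out of
  the starting point stays below the end point, and the interval is not linear.

  Hence the number of linear intervals of height \<open>k\<close> is the number of elements for \<open>k = 0\<close>. For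
  \<open>k > 0\<close>, let \<open>N\<close> be the number of pairs of an element and a label \<open>x\<close> that admits \<open>k\<close>
  successive moves from this element. By the symmetry there are as many chains with constant
  \<open>y\<close>. The two kinds of chain coincide for \<open>k = 1\<close>, which gives \<open>N\<close> intervals, and exclude each
  other for \<open>k \<ge> 2\<close>, which gives \<open>2 N\<close>; this is the lemma \<open>card_linear_intervals\<close>. Finally, in a
  tree the label \<open>x\<close> can be moved as often as there are nodes on the leftmost branch of the right
  subtree of \<open>x\<close>, in a path as often as there are up steps immediately after the \<open>x\<close>-th down
  step. The bijection sending the tree \<open>(l, r)\<close> to the path \<open>u l d r\<close> matches these two numbers
  for every \<open>x\<close>, so \<open>N\<close> is the same on both sides.\<close>

section \<open>Linear intervals in posets with labelled covers\<close>

text \<open>A finite poset whose order is generated by moves: \<open>E x y P Q\<close> says that \<open>Q\<close> arises from \<open>P\<close> by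
  a move with labels \<open>x\<close> and \<open>y\<close>, both below \<open>n\<close>. The vector \<open>pot\<close> witnesses which first
  labels occur, \<open>run P ! x\<close> is the number of successive moves with first label \<open>x\<close> that are
  possible from \<open>P\<close>, and \<open>mir\<close> is an involution exchanging the roles of the two labels, which
  reverses the order or preserves it according to \<open>anti\<close>.

  The last three assumptions bound the ways in which labels may change along a linear interval.
  Unless the labels cannot change in this way at all, there is a second move \<open>E z w P P'\<close> out
  of \<open>P\<close> with \<open>z \<noteq> x\<close>, which leads to an element incomparable to \<open>Q\<close>.\<close>

locale labelled_covers =
  fixes A :: "'a set" and n :: nat and le :: "'a \<Rightarrow> 'a \<Rightarrow> bool"
    and E :: "nat \<Rightarrow> nat \<Rightarrow> 'a \<Rightarrow> 'a \<Rightarrow> bool"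
    and pot :: "'a \<Rightarrow> nat list" and run :: "'a \<Rightarrow> nat list" and mir :: "'a \<Rightarrow> 'a"
    and anti :: bool
  assumes finite_carrier: "finite A"
    and le_iff: "P \<in> A \<Longrightarrow> Q \<in> A \<Longrightarrow> le P Q \<longleftrightarrow> (\<lambda>P Q. \<exists>x y. E x y P Q)\<^sup>*\<^sup>* P Q"
    and E_carrier: "E x y P Q \<Longrightarrow> P \<in> A \<and> Q \<in> A \<and> x < n \<and> y < n"
    and pot_less: "E x y P Q \<Longrightarrow> pot Q ! x < pot P ! x"
    and pot_eq: "E x y P Q \<Longrightarrow> z \<noteq> x \<Longrightarrow> pot Q ! z = pot P ! z"
    and E_deterministic: "E x y P Q \<Longrightarrow> E x y' P Q' \<Longrightarrow> Q' = Q"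
    and E_no_repeat: "E x y P Q \<Longrightarrow> \<not> E x y Q R"
    and run_step: "E x y P Q \<Longrightarrow> run P ! x = Suc (run Q ! x)"
    and run_ex: "P \<in> A \<Longrightarrow> x < n \<Longrightarrow> 0 < run P ! x \<Longrightarrow> \<exists>y Q. E x y P Q"
    and mir_carrier: "P \<in> A \<Longrightarrow> mir P \<in> A"
    and mir_mir: "P \<in> A \<Longrightarrow> mir (mir P) = P"
    and mir_E: "E x y P Q \<Longrightarrow> if anti then E (n - 1 - y) (n - 1 - x) (mir Q) (mir P)
      else E (n - 1 - y) (n - 1 - x) (mir P) (mir Q)"
    and E_both_change: "E x y P Q \<Longrightarrow> E x' y' Q R \<Longrightarrow> x \<noteq> x' \<Longrightarrow> y \<noteq> y' \<Longrightarrow>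
      \<exists>z w P'. E z w P P' \<and> z \<noteq> x \<and> le P' R"
    and E_x_then_y: "E x y P Q \<Longrightarrow> E x y' Q R \<Longrightarrow> E x' y' R R' \<Longrightarrow> False"
    and E_y_then_x: "E x y P Q \<Longrightarrow> E x' y Q R \<Longrightarrow> E x' y' R R' \<Longrightarrow>
      \<exists>z w P'. E z w P P' \<and> z \<noteq> x \<and> le P' R'"
begin

definition cover :: "'a \<Rightarrow> 'a \<Rightarrow> bool" where
  "cover P Q \<longleftrightarrow> (\<exists>x y. E x y P Q)"

text \<open>Moves whose first, respectively second, label is prescribed. The powers of these relations are
  the chains of moves with one constant label.\<close>

definition x_cover :: "nat \<Rightarrow> 'a \<Rightarrow> 'a \<Rightarrow> bool" where
  "x_cover x P Q \<longleftrightarrow> (\<exists>y. E x y P Q)"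

definition y_cover :: "nat \<Rightarrow> 'a \<Rightarrow> 'a \<Rightarrow> bool" where
  "y_cover y P Q \<longleftrightarrow> (\<exists>x. E x y P Q)"

lemma le_iff_cover_star: "P \<in> A \<Longrightarrow> Q \<in> A \<Longrightarrow> le P Q \<longleftrightarrow> cover\<^sup>*\<^sup>* P Q"
  using le_iff unfolding cover_def by simp

lemma cover_carrier: "cover P Q \<Longrightarrow> P \<in> A \<and> Q \<in> A"
  using E_carrier unfolding cover_def by blast

lemma x_cover_cover: "x_cover x P Q \<Longrightarrow> cover P Q"
  and y_cover_cover: "y_cover y P Q \<Longrightarrow> cover P Q"
  unfolding x_cover_def y_cover_def cover_def by blast+

lemma x_chain_cover_pow: "(x_cover x ^^ k) P Q \<Longrightarrow> (cover ^^ k) P Q"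
  by (metis x_cover_cover relpowp_mono)

lemma y_chain_cover_pow: "(y_cover y ^^ k) P Q \<Longrightarrow> (cover ^^ k) P Q"
  by (metis y_cover_cover relpowp_mono)

lemma cover_star_carrier: "cover\<^sup>*\<^sup>* P Q \<Longrightarrow> P \<in> A \<Longrightarrow> Q \<in> A"
  by (induction rule: rtranclp_induct) (auto dest: cover_carrier)

lemma cover_pow_carrier: "(cover ^^ k) P Q \<Longrightarrow> P \<in> A \<Longrightarrow> Q \<in> A"
  using cover_star_carrier relpowp_imp_rtranclp by metis

lemma cover_pow_le: "(cover ^^ k) P Q \<Longrightarrow> P \<in> A \<Longrightarrow> le P Q"
  using cover_pow_carrier le_iff_cover_star relpowp_imp_rtranclp by metis

lemma cover_le: "cover P Q \<Longrightarrow> le P Q"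
  using cover_carrier le_iff_cover_star by blast

lemma le_refl: "P \<in> A \<Longrightarrow> le P P"
  by (simp add: le_iff_cover_star)

lemma le_trans: "le P Q \<Longrightarrow> le Q R \<Longrightarrow> P \<in> A \<Longrightarrow> Q \<in> A \<Longrightarrow> R \<in> A \<Longrightarrow> le P R"
  by (auto simp: le_iff_cover_star intro: rtranclp_trans)

lemma pot_antimono: "le P Q \<Longrightarrow> P \<in> A \<Longrightarrow> Q \<in> A \<Longrightarrow> pot Q ! z \<le> pot P ! z"
proof -
  have *: "cover\<^sup>*\<^sup>* P Q \<Longrightarrow> pot Q ! z \<le> pot P ! z"
  proof (induction rule: rtranclp_induct)
    case (step Q R)
    then obtain x y where "E x y Q R" by (auto simp: cover_def)
    then have "pot R ! z \<le> pot Q ! z"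
      by (metis less_imp_le order_refl pot_eq pot_less)
    with step show ?case by linarith
  qed simp
  show "le P Q \<Longrightarrow> P \<in> A \<Longrightarrow> Q \<in> A \<Longrightarrow> pot Q ! z \<le> pot P ! z" using * by (simp add: le_iff_cover_star)
qed

lemma le_antisym:
  assumes "le P Q" "le Q P" "P \<in> A" "Q \<in> A"
  shows "P = Q"
proof (rule ccontr)
  assume ne: "P \<noteq> Q"
  have "cover\<^sup>*\<^sup>* P Q" using assms le_iff_cover_star by blast
  then obtain R where R: "cover P R" "cover\<^sup>*\<^sup>* R Q"
    using ne by (metis converse_rtranclpE)
  then obtain x y where E: "E x y P R" by (auto simp: cover_def)
  have "R \<in> A" "le R Q" using R assms cover_carrier le_iff_cover_star by blast+
  then have "pot P ! x \<le> pot R ! x"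
    using assms le_trans pot_antimono by blast
  with pot_less[OF E] show False by simp
qed

lemma cover_neq: "cover P Q \<Longrightarrow> P \<noteq> Q"
  unfolding cover_def using pot_less by blast

lemma finite_interval: "finite (interval A le P Q)"
  using finite_carrier by (simp add: interval_def)

lemma interval_mono:
  assumes "P \<in> A" "P' \<in> A" "Q \<in> A" "Q' \<in> A" "le P P'" "le Q' Q"
  shows "interval A le P' Q' \<subseteq> interval A le P Q"
  using assms le_trans unfolding interval_def by blast

lemma chain_mono:
  assumes c: "chain_between A le P Q k c" and "i \<le> j" "j \<le> k"
  shows "le (c i) (c j)"
  using assms(2,3)
proof (induction j rule: dec_induct)
  case base
  then show ?case using c le_refl by (simp add: chain_between_def)
next
  case (step m)
  moreover have "le (c m) (c (Suc m))" "c i \<in> A" "c m \<in> A" "c (Suc m) \<in> A"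
    using c step unfolding chain_between_def by auto
  ultimately show ?case using le_trans by (meson Suc_leD)
qed

lemma chain_length:
  assumes c: "chain_between A le P Q k c"
  shows "Suc k \<le> card (interval A le P Q)"
proof -
  have cA: "c i \<in> A" if "i \<le> k" for i using c that by (simp add: chain_between_def)
  have ne: "c i \<noteq> c j" if "i < j" "j \<le> k" for i j
  proof
    assume eq: "c i = c j"
    have "le (c (Suc i)) (c i)" using chain_mono[OF c, of "Suc i" j] that eq by simp
    moreover have "le (c i) (c (Suc i))" "c i \<noteq> c (Suc i)"
      using c that unfolding chain_between_def by auto
    ultimately show False using le_antisym cA that by (meson Suc_leI le_trans less_imp_le_nat order_trans)
  qed
  have "inj_on c {..k}"
    by (intro inj_onI) (metis atMost_iff linorder_neqE_nat ne)
  moreover have "c ` {..k} \<subseteq> interval A le P Q"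
    using chain_mono[OF c] cA c unfolding interval_def chain_between_def by force
  ultimately have "card {..k} \<le> card (interval A le P Q)"
    using card_inj_on_le finite_interval by metis
  then show ?thesis by simp
qed

lemma cover_pow_chain:
  assumes "(cover ^^ k) P Q" "P \<in> A"
  shows "\<exists>c. chain_between A le P Q k c"
proof -
  obtain c where c: "c 0 = P" "c k = Q" "\<forall>i<k. cover (c i) (c (Suc i))"
    using assms(1) unfolding relpowp_fun_conv by blast
  have "c i \<in> A" if "i \<le> k" for i
    using that c(1,3) assms(2) cover_carrier by (cases i) (auto simp: Suc_le_eq)
  then have "chain_between A le P Q k c"
    using c cover_le cover_neq unfolding chain_between_def by blast
  then show ?thesis by blast
qed

text \<open>A path of \<open>k\<close> moves is a chain of length \<open>k\<close>, and chains are shorter than the cardinality of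
  the interval.\<close>

lemma height_eq:
  assumes "(cover ^^ k) P Q" "P \<in> A" "card (interval A le P Q) \<le> Suc k"
  shows "interval_height A le P Q = k"
proof -
  have le: "j \<le> k" if "chain_between A le P Q j c" for j c
    using chain_length[OF that] assms(3) by linarith
  then have "{j. \<exists>c. chain_between A le P Q j c} \<subseteq> {..k}" by auto
  then have "finite {j. \<exists>c. chain_between A le P Q j c}"
    using finite_subset by blast
  then show ?thesis unfolding interval_height_def
    using le cover_pow_chain[OF assms(1,2)] by (intro Max_eqI) auto
qed

lemma x_chain_pot_eq: "(x_cover x ^^ k) P Q \<Longrightarrow> z \<noteq> x \<Longrightarrow> pot Q ! z = pot P ! z"
proof (induction k arbitrary: Q)
  case (Suc k)
  obtain R where R: "(x_cover x ^^ k) P R" "x_cover x R Q" using Suc.prems(1) by (rule relpowp_Suc_E)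
  from R(2) obtain y where "E x y R Q" unfolding x_cover_def ..
  then show ?case using Suc.IH[OF R(1) Suc.prems(2)] pot_eq Suc.prems(2) by simp
qed simp

text \<open>A chain with constant label \<open>x\<close> leaves the other entries of \<open>pot\<close> unchanged, whereas a move
  with another first label would lower one of them for good.\<close>

lemma x_chain_first_label:
  assumes "(x_cover x ^^ k) P Q" "E x' y P R" "le R Q"
  shows "x' = x"
proof (rule ccontr)
  assume "x' \<noteq> x"
  moreover have "P \<in> A" "R \<in> A" using E_carrier assms by blast+
  moreover have "Q \<in> A" using cover_pow_carrier x_chain_cover_pow assms(1) \<open>P \<in> A\<close> by blast
  ultimately show False
    using x_chain_pot_eq[OF assms(1)] pot_less[OF assms(2)] pot_antimono[OF assms(3)]
    by (metis not_less)
qed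

lemma x_cover_deterministic: "x_cover x P Q \<Longrightarrow> x_cover x P Q' \<Longrightarrow> Q' = Q"
  unfolding x_cover_def using E_deterministic by blast

lemma x_chain_deterministic: "(x_cover x ^^ k) P Q \<Longrightarrow> (x_cover x ^^ k) P Q' \<Longrightarrow> Q' = Q"
proof (induction k arbitrary: Q Q')
  case (Suc k)
  then show ?case by (metis x_cover_deterministic relpowp_Suc_E)
qed simp

text \<open>Any first move from \<open>P\<close> towards an element of the interval has label \<open>x\<close>, so it is the first
  move of the chain; induction then places the whole interval on the chain.\<close>

lemma x_chain_interval:
  assumes "(x_cover x ^^ k) P Q" "R \<in> interval A le P Q" "P \<in> A"
  shows "\<exists>i\<le>k. (x_cover x ^^ i) P R"
  using assms
proof (induction k arbitrary: P)
  case 0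
  then have "R = P" using le_antisym unfolding interval_def by auto
  then show ?case by auto
next
  case (Suc k)
  obtain P1 where P1: "x_cover x P P1" "(x_cover x ^^ k) P1 Q" using Suc.prems(1) by (rule relpowp_Suc_E2)
  have R: "R \<in> A" "le P R" "le R Q" using Suc.prems unfolding interval_def by auto
  have QA: "Q \<in> A" using Suc.prems cover_pow_carrier x_chain_cover_pow by blast
  show ?case
  proof (cases "R = P")
    case True
    then show ?thesis by (intro exI[of _ 0]) auto
  next
    case False
    have "cover\<^sup>*\<^sup>* P R" using R Suc.prems le_iff_cover_star by blast
    then obtain P' where P': "cover P P'" "cover\<^sup>*\<^sup>* P' R" using False by (metis converse_rtranclpE)
    then have P'A: "P' \<in> A" and "le P' R" using cover_carrier R le_iff_cover_star by blast+
    then have "le P' Q" using R QA le_trans by blast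
    moreover obtain x' y where E: "E x' y P P'" using P' cover_def by blast
    ultimately have "x' = x" using x_chain_first_label Suc.prems(1) by blast
    then have "P' = P1" using E P1 x_cover_deterministic unfolding x_cover_def by blast
    then have "R \<in> interval A le P1 Q" using \<open>le P' R\<close> R unfolding interval_def by blast
    from Suc.IH[OF P1(2) this] P'A \<open>P' = P1\<close>
    obtain i where i: "i \<le> k" "(x_cover x ^^ i) P1 R" by blast
    then show ?thesis using relpowp_Suc_I2[of "x_cover x", OF P1(1) i(2)]
      by (intro exI[of _ "Suc i"]) simp
  qed
qed

lemma x_chain_linear:
  assumes "(x_cover x ^^ k) P Q" "P \<in> A"
  shows "totalp_on (interval A le P Q) le" and "card (interval A le P Q) \<le> Suc k"
proof -
  have *: "le R R'" if "(x_cover x ^^ i) P R" "(x_cover x ^^ j) P R'" "i \<le> j" for i j R R'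
  proof -
    have "(x_cover x ^^ (i + (j - i))) P R'" using that by simp
    then obtain T where T: "(x_cover x ^^ i) P T" "(x_cover x ^^ (j - i)) T R'"
      unfolding relpowp_add by blast
    then have "T = R" using that x_chain_deterministic by blast
    then show ?thesis using T x_chain_cover_pow cover_pow_le cover_pow_carrier assms by blast
  qed
  show "totalp_on (interval A le P Q) le"
    by (intro totalp_onI) (metis x_chain_interval[OF assms(1) _ assms(2)] * nle_le)
  have "interval A le P Q \<subseteq> (\<lambda>i. THE R. (x_cover x ^^ i) P R) ` {..k}"
  proof
    fix R assume "R \<in> interval A le P Q"
    then obtain i where i: "i \<le> k" "(x_cover x ^^ i) P R" using x_chain_interval assms by blast
    then have "(THE R. (x_cover x ^^ i) P R) = R" using x_chain_deterministic by blast
    then show "R \<in> (\<lambda>i. THE R. (x_cover x ^^ i) P R) ` {..k}" using i by force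
  qed
  then have "card (interval A le P Q) \<le> card {..k}" by (rule surj_card_le[rotated]) simp
  then show "card (interval A le P Q) \<le> Suc k" by simp
qed

text \<open>Application of a relation to the mirror images, in the order dictated by \<open>anti\<close>.\<close>

definition mir_rel :: "('a \<Rightarrow> 'a \<Rightarrow> bool) \<Rightarrow> 'a \<Rightarrow> 'a \<Rightarrow> bool" where
  "mir_rel R P Q = (if anti then R (mir Q) (mir P) else R (mir P) (mir Q))"

lemma mir_x_cover: "x_cover x P Q \<Longrightarrow> mir_rel (y_cover (n - 1 - x)) P Q"
  and mir_y_cover: "y_cover y P Q \<Longrightarrow> mir_rel (x_cover (n - 1 - y)) P Q"
  and mir_cover: "cover P Q \<Longrightarrow> mir_rel cover P Q"
  unfolding x_cover_def y_cover_def cover_def mir_rel_def using mir_E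
  by (cases anti; simp only: if_True if_False; blast)+

lemma mir_pow:
  assumes step: "\<And>P Q. R P Q \<Longrightarrow> mir_rel R' P Q" and "(R ^^ k) P Q"
  shows "mir_rel (R' ^^ k) P Q"
  using assms(2)
proof (induction k arbitrary: Q)
  case 0
  then show ?case by (simp add: mir_rel_def)
next
  case (Suc k)
  obtain T where "(R ^^ k) P T" "R T Q" using Suc.prems by (rule relpowp_Suc_E)
  then have "mir_rel (R' ^^ k) P T" "mir_rel R' T Q" using Suc.IH step by blast+
  then show ?case unfolding mir_rel_def
    by (auto split: if_splits intro: relpowp_Suc_I2 relpowp_Suc_I simp del: relpowp.simps)
qed

lemma mir_le:
  assumes "le P Q" "P \<in> A" "Q \<in> A" shows "mir_rel le P Q"
proof -
  have "cover\<^sup>*\<^sup>* P Q" using assms le_iff_cover_star by blast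
  then obtain k where "(cover ^^ k) P Q" using rtranclp_imp_relpowp by metis
  then have "mir_rel (cover ^^ k) P Q" using mir_pow mir_cover by blast
  then show ?thesis using assms mir_carrier cover_pow_le unfolding mir_rel_def by auto
qed

lemma y_chain_linear:
  assumes "(y_cover y ^^ k) P Q" "P \<in> A"
  shows "totalp_on (interval A le P Q) le" and "card (interval A le P Q) \<le> Suc k"
proof -
  have QA: "Q \<in> A" using assms cover_pow_carrier y_chain_cover_pow by blast
  have pow: "mir_rel (x_cover (n - 1 - y) ^^ k) P Q" by (rule mir_pow[OF mir_y_cover assms(1)])
  have mem: "mir_rel le P R" "mir_rel le R Q" "mir R \<in> A" if "R \<in> interval A le P Q" for R
    using that mir_le mir_carrier assms(2) QA unfolding interval_def by blast+
  obtain P' Q' where PQ: "P' \<in> A" "(x_cover (n - 1 - y) ^^ k) P' Q'"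
    and img: "mir ` interval A le P Q \<subseteq> interval A le P' Q'"
  proof (cases anti)
    case True
    have "mir ` interval A le P Q \<subseteq> interval A le (mir Q) (mir P)"
      using mem True unfolding mir_rel_def interval_def[of A le "mir Q"] by auto
    with pow True show ?thesis
      unfolding mir_rel_def by (intro that[of "mir Q" "mir P"] mir_carrier QA) auto
  next
    case False
    have "mir ` interval A le P Q \<subseteq> interval A le (mir P) (mir Q)"
      using mem False unfolding mir_rel_def interval_def[of A le "mir P"] by auto
    with pow False show ?thesis
      unfolding mir_rel_def by (intro that[of "mir P" "mir Q"] mir_carrier assms(2)) auto
  qed
  note lin = x_chain_linear[OF PQ(2,1)]
  have I: "R \<in> A" if "R \<in> interval A le P Q" for R using that by (simp add: interval_def)
  have inj: "inj_on mir (interval A le P Q)"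
    by (intro inj_onI) (metis I mir_mir)
  show "totalp_on (interval A le P Q) le"
  proof (intro totalp_onI)
    fix R T assume RT: "R \<in> interval A le P Q" "T \<in> interval A le P Q" "R \<noteq> T"
    then have "mir R \<noteq> mir T" using inj by (simp add: inj_on_eq_iff)
    then have "le (mir R) (mir T) \<or> le (mir T) (mir R)"
      using lin(1) img RT unfolding totalp_on_def by blast
    then have "mir_rel le (mir R) (mir T) \<or> mir_rel le (mir T) (mir R)"
      using mir_le mir_carrier RT I by blast
    then show "le R T \<or> le T R" using mir_mir RT I unfolding mir_rel_def by (auto split: if_splits)
  qed
  have "card (interval A le P Q) \<le> card (interval A le P' Q')"
    by (rule card_inj_on_le[OF inj img finite_interval])
  then show "card (interval A le P Q) \<le> Suc k" using lin(2) by simp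
qed

text \<open>Two moves out of \<open>P\<close> with different first labels lead to incomparable elements: each of them
  lowers an entry of \<open>pot\<close> that the other one leaves unchanged.\<close>

lemma fork_not_total:
  assumes "E x y P Q" "E z w P P'" "z \<noteq> x" "le Q R" "le P' R" "R \<in> A"
  shows "\<not> totalp_on (interval A le P R) le"
proof
  assume tot: "totalp_on (interval A le P R) le"
  have A: "P \<in> A" "Q \<in> A" "P' \<in> A" using E_carrier assms by blast+
  have "le P Q" "le P P'" using assms cover_le unfolding cover_def by blast+
  then have "Q \<in> interval A le P R" "P' \<in> interval A le P R"
    using A assms unfolding interval_def by auto
  moreover have "pot Q ! x < pot P' ! x" "pot P' ! z < pot Q ! z"
    using pot_less[OF assms(1)] pot_less[OF assms(2)] pot_eq[OF assms(1)] pot_eq[OF assms(2)] assms(3)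
    by metis+
  moreover from this have "\<not> le Q P'" "\<not> le P' Q" "Q \<noteq> P'"
    using pot_antimono[OF _ A(2,3)] pot_antimono[OF _ A(3,2)] by (auto simp: not_less[symmetric])
  ultimately show False using tot unfolding totalp_on_def by blast
qed

text \<open>The converse: every path of moves across a linear interval keeps one of its labels constant.
  By induction this holds after the first move. The first two moves share a label, and if that is not
  the label kept by the rest of the path, then the first three moves change one label and then
  the other.\<close>

lemma total_path_monochromatic:
  assumes "(cover ^^ j) P Q" "P \<in> A" "totalp_on (interval A le P Q) le"
  shows "(\<exists>x. (x_cover x ^^ j) P Q) \<or> (\<exists>y. (y_cover y ^^ j) P Q)"
  using assms
proof (induction j arbitrary: P)
  case (Suc j)
  obtain P1 where P1: "cover P P1" "(cover ^^ j) P1 Q" using Suc.prems(1) by (rule relpowp_Suc_E2)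
  obtain x0 y0 where E0: "E x0 y0 P P1" using P1 cover_def by blast
  then have X0: "x_cover x0 P P1" and Y0: "y_cover y0 P P1" unfolding x_cover_def y_cover_def by blast+
  have P1A: "P1 \<in> A" using P1 cover_carrier by blast
  have QA: "Q \<in> A" using Suc.prems cover_pow_carrier by blast
  have P1Q: "le P1 Q" using P1 P1A cover_pow_le by blast
  have nofork: False if "E z w P P'" "z \<noteq> x0" "le P' R" "(cover ^^ i) R Q" "R \<in> A" for z w P' R i
  proof -
    have "le P' Q" using that le_trans QA E_carrier cover_pow_le by blast
    then show False using fork_not_total[OF E0 that(1,2) P1Q _ QA] Suc.prems by blast
  qed
  have "totalp_on (interval A le P1 Q) le"
    using Suc.prems interval_mono[of P P1 Q Q] P1A QA P1(1) cover_le le_refl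
    by (meson totalp_on_subset)
  then have IH: "(\<exists>x. (x_cover x ^^ j) P1 Q) \<or> (\<exists>y. (y_cover y ^^ j) P1 Q)"
    using Suc.IH P1 P1A by blast
  show ?case
  proof (cases j)
    case 0
    then have "x_cover x0 P Q" using E0 P1 unfolding x_cover_def by auto
    then show ?thesis using 0 by auto
  next
    case (Suc i)
    have XI: ?thesis if "(x_cover x0 ^^ j) P1 Q"
      using relpowp_Suc_I2[of "x_cover x0", OF X0 that] by blast
    have YI: ?thesis if "(y_cover y0 ^^ j) P1 Q"
      using relpowp_Suc_I2[of "y_cover y0", OF Y0 that] by blast
    from IH show ?thesis
    proof (elim disjE exE)
      fix x assume x: "(x_cover x ^^ j) P1 Q"
      obtain P2 where "x_cover x P1 P2" and XP2: "(x_cover x ^^ i) P2 Q"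
        using x[unfolded Suc] by (rule relpowp_Suc_E2)
      then obtain y1 where P2: "E x y1 P1 P2" unfolding x_cover_def by blast
      have "x0 = x \<or> y0 = y1"
        using E_both_change[OF E0 P2] nofork[OF _ _ _ x_chain_cover_pow[OF XP2]] E_carrier[OF P2] by blast
      then show ?thesis
      proof
        assume "x0 = x" then show ?thesis using x XI by blast
      next
        assume y: "y0 = y1"
        show ?thesis
        proof (cases i)
          case 0
          then have "(y_cover y0 ^^ j) P1 Q" using P2 XP2 y Suc unfolding y_cover_def by auto
          then show ?thesis by (rule YI)
        next
          case (Suc h)
          obtain P3 where "x_cover x P2 P3" and XP3: "(x_cover x ^^ h) P3 Q"
            using XP2[unfolded Suc] by (rule relpowp_Suc_E2)
          then obtain y2 where P3: "E x y2 P2 P3" unfolding x_cover_def by blast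
          show ?thesis
            using E_y_then_x[OF E0[unfolded y] P2 P3] nofork[OF _ _ _ x_chain_cover_pow[OF XP3]]
              E_carrier[OF P3] by blast
        qed
      qed
    next
      fix y assume y: "(y_cover y ^^ j) P1 Q"
      obtain P2 where "y_cover y P1 P2" and YP2: "(y_cover y ^^ i) P2 Q"
        using y[unfolded Suc] by (rule relpowp_Suc_E2)
      then obtain x1 where P2: "E x1 y P1 P2" unfolding y_cover_def by blast
      have "x0 = x1 \<or> y0 = y"
        using E_both_change[OF E0 P2] nofork[OF _ _ _ y_chain_cover_pow[OF YP2]] E_carrier[OF P2] by blast
      then show ?thesis
      proof
        assume "y0 = y" then show ?thesis using y YI by blast
      next
        assume x: "x0 = x1"
        show ?thesis
        proof (cases i)
          case 0
          then have "(x_cover x0 ^^ j) P1 Q" using P2 YP2 x Suc unfolding x_cover_def by auto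
          then show ?thesis by (rule XI)
        next
          case (Suc h)
          obtain P3 where "y_cover y P2 P3" "(y_cover y ^^ h) P3 Q"
            using YP2[unfolded Suc] by (rule relpowp_Suc_E2)
          then obtain x2 where P3: "E x2 y P2 P3" unfolding y_cover_def by blast
          show ?thesis using E_x_then_y[OF E0[unfolded x] P2 P3] by blast
        qed
      qed
    qed
  qed
qed simp

lemma linear_path:
  assumes "P \<in> A" "Q \<in> A" "le P Q" "totalp_on (interval A le P Q) le"
    "interval_height A le P Q = k"
  shows "(\<exists>x. (x_cover x ^^ k) P Q) \<or> (\<exists>y. (y_cover y ^^ k) P Q)"
proof -
  have "cover\<^sup>*\<^sup>* P Q" using assms le_iff_cover_star by blast
  then obtain j where j: "(cover ^^ j) P Q" using rtranclp_imp_relpowp by metis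
  then have *: "(\<exists>x. (x_cover x ^^ j) P Q) \<or> (\<exists>y. (y_cover y ^^ j) P Q)"
    using total_path_monochromatic assms by blast
  then have "card (interval A le P Q) \<le> Suc j"
    using x_chain_linear(2) y_chain_linear(2) assms by blast
  then have "j = k" using height_eq[OF j] assms by blast
  then show ?thesis using * by blast
qed

text \<open>The pairs of end points of the chains of \<open>k\<close> moves with constant first, respectively second,
  label. The bound on the label is automatic for \<open>k > 0\<close>.\<close>

definition x_chains :: "nat \<Rightarrow> ('a \<times> 'a) set" where
  "x_chains k = {(P, Q). P \<in> A \<and> (\<exists>x<n. (x_cover x ^^ k) P Q)}"

definition y_chains :: "nat \<Rightarrow> ('a \<times> 'a) set" where
  "y_chains k = {(P, Q). P \<in> A \<and> (\<exists>y<n. (y_cover y ^^ k) P Q)}"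

lemma x_chain_label_less: "(x_cover x ^^ k) P Q \<Longrightarrow> 0 < k \<Longrightarrow> x < n"
  by (cases k) (auto simp: x_cover_def dest: E_carrier)

lemma y_chain_label_less: "(y_cover y ^^ k) P Q \<Longrightarrow> 0 < k \<Longrightarrow> y < n"
  by (cases k) (auto simp: y_cover_def dest: E_carrier)

lemma linear_interval_iff:
  assumes "P \<in> A" "Q \<in> A" "le P Q" "0 < k"
  shows "totalp_on (interval A le P Q) le \<and> interval_height A le P Q = k \<longleftrightarrow>
    (P, Q) \<in> x_chains k \<union> y_chains k" (is "?L \<longleftrightarrow> ?R")
proof
  assume L: ?L
  then show ?R
    using linear_path assms x_chain_label_less y_chain_label_less
    unfolding x_chains_def y_chains_def by blast
next
  assume ?R
  then consider (x_cover) x where "(x_cover x ^^ k) P Q" | (y_cover) y where "(y_cover y ^^ k) P Q"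
    unfolding x_chains_def y_chains_def by blast
  then show ?L
  proof cases
    case x_cover
    then show ?thesis using x_chain_linear height_eq x_chain_cover_pow assms by blast
  next
    case y_cover
    then show ?thesis using y_chain_linear height_eq y_chain_cover_pow assms by blast
  qed
qed

lemma interval_inj:
  assumes "interval A le P Q = interval A le P' Q'" "le P Q" "le P' Q'"
    "P \<in> A" "Q \<in> A" "P' \<in> A" "Q' \<in> A"
  shows "P = P' \<and> Q = Q'"
proof -
  have "P \<in> interval A le P Q" "Q \<in> interval A le P Q"
    "P' \<in> interval A le P' Q'" "Q' \<in> interval A le P' Q'"
    using assms le_refl by (auto simp: interval_def)
  then have "le P P'" "le P' P" "le Q Q'" "le Q' Q"
    using assms by (auto simp: interval_def)
  then show ?thesis using le_antisym assms by blast
qed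

lemma card_linear_intervals_pos:
  assumes "0 < k"
  shows "card (linear_intervals A le k) = card (x_chains k \<union> y_chains k)"
proof -
  have le: "P \<in> A \<and> Q \<in> A \<and> le P Q" if "(P, Q) \<in> x_chains k \<union> y_chains k" for P Q
    using that cover_pow_carrier cover_pow_le x_chain_cover_pow y_chain_cover_pow unfolding x_chains_def y_chains_def by blast
  have "linear_intervals A le k = (\<lambda>(P, Q). interval A le P Q) ` (x_chains k \<union> y_chains k)"
  proof (intro set_eqI iffI)
    fix I assume "I \<in> linear_intervals A le k"
    then show "I \<in> (\<lambda>(P, Q). interval A le P Q) ` (x_chains k \<union> y_chains k)"
      using linear_interval_iff[OF _ _ _ assms] unfolding linear_intervals_def by force
  next
    fix I assume "I \<in> (\<lambda>(P, Q). interval A le P Q) ` (x_chains k \<union> y_chains k)"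
    then obtain P Q where "(P, Q) \<in> x_chains k \<union> y_chains k" "I = interval A le P Q" by auto
    then show "I \<in> linear_intervals A le k"
      using linear_interval_iff[OF _ _ _ assms] le unfolding linear_intervals_def by blast
  qed
  moreover have "inj_on (\<lambda>(P, Q). interval A le P Q) (x_chains k \<union> y_chains k)"
  proof (rule inj_onI)
    fix p q assume pq: "p \<in> x_chains k \<union> y_chains k" "q \<in> x_chains k \<union> y_chains k"
      "(\<lambda>(P, Q). interval A le P Q) p = (\<lambda>(P, Q). interval A le P Q) q"
    obtain P Q P' Q' where e: "p = (P, Q)" "q = (P', Q')" by (cases p, cases q)
    show "p = q" using interval_inj[of P Q P' Q'] le[of P Q] le[of P' Q'] pq unfolding e by simp
  qed
  ultimately show ?thesis by (simp add: card_image)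
qed

lemma card_linear_intervals_0: "card (linear_intervals A le 0) = card A"
proof -
  have I: "interval A le P P = {P}" if "P \<in> A" for P
    using that le_refl le_antisym unfolding interval_def by blast
  have "interval_height A le P P = 0" if "P \<in> A" for P
    using height_eq[of 0 P P] that I by simp
  moreover have "P = Q" if "P \<in> A" "Q \<in> A" "le P Q" "interval_height A le P Q = 0"
     "totalp_on (interval A le P Q) le" for P Q
    using linear_path[OF that(1-3,5,4)] by auto
  moreover have "totalp_on {P} le" for P by (simp add: totalp_on_def)
  ultimately have "I \<in> linear_intervals A le 0 \<longleftrightarrow> (\<exists>P\<in>A. I = {P})" for I
    using I le_refl unfolding linear_intervals_def mem_Collect_eq by metis
  then have "linear_intervals A le 0 = (\<lambda>P. {P}) ` A" by auto
  then show ?thesis by (simp add: card_image)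
qed

lemma card_y_chains: "card (y_chains k) = card (x_chains k)"
proof (rule bij_betw_same_card)
  have XA: "P \<in> A \<and> Q \<in> A" if "(P, Q) \<in> x_chains k" for P Q
    using that cover_pow_carrier x_chain_cover_pow unfolding x_chains_def by blast
  have YA: "P \<in> A \<and> Q \<in> A" if "(P, Q) \<in> y_chains k" for P Q
    using that cover_pow_carrier y_chain_cover_pow unfolding y_chains_def by blast
  have flip: "n - 1 - x < n" if "x < n" for x using that by simp
  let ?m = "\<lambda>(P, Q). if anti then (mir Q, mir P) else (mir P, mir Q)"
  have YX: "?m p \<in> x_chains k" if p: "p \<in> y_chains k" for p
  proof -
    obtain P Q y where e: "p = (P, Q)" "P \<in> A" "Q \<in> A" "y < n" "(y_cover y ^^ k) P Q"
      using p YA unfolding y_chains_def by blast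
    then obtain x where "x < n" "mir_rel (x_cover x ^^ k) P Q" using mir_pow mir_y_cover flip by blast
    then show ?thesis using e mir_carrier unfolding x_chains_def mir_rel_def by auto
  qed
  have XY: "?m p \<in> y_chains k" if p: "p \<in> x_chains k" for p
  proof -
    obtain P Q x where e: "p = (P, Q)" "P \<in> A" "Q \<in> A" "x < n" "(x_cover x ^^ k) P Q"
      using p XA unfolding x_chains_def by blast
    then obtain y where "y < n" "mir_rel (y_cover y ^^ k) P Q" using mir_pow mir_x_cover flip by blast
    then show ?thesis using e mir_carrier unfolding y_chains_def mir_rel_def by auto
  qed
  show "bij_betw ?m (y_chains k) (x_chains k)"
    by (rule bij_betw_byWitness[where f' = ?m]) (use XA YA XY YX mir_mir in auto)
qed

lemma x_chains_1_eq_y_chains_1: "x_chains 1 = y_chains 1"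
proof -
  have "(\<exists>x<n. x_cover x P Q) \<longleftrightarrow> (\<exists>y<n. y_cover y P Q)" for P Q
    unfolding x_cover_def y_cover_def using E_carrier by blast
  then show ?thesis unfolding x_chains_def y_chains_def by (simp add: eq_OO)
qed

text \<open>If a chain with constant \<open>x\<close> and one with constant \<open>y\<close> span the same interval, then their
  first two moves agree, and so both labels are repeated.\<close>

lemma x_chains_y_chains_disjoint:
  assumes "2 \<le> k" shows "x_chains k \<inter> y_chains k = {}"
proof -
  have False if P: "P \<in> A" and x: "(x_cover x ^^ k) P Q" and y: "(y_cover y ^^ k) P Q" for P Q x y
  proof -
    obtain j where j: "k = Suc (Suc j)" using assms by (metis add_2_eq_Suc le_Suc_ex)
    obtain P1 where X1: "x_cover x P P1" and X1k: "(x_cover x ^^ Suc j) P1 Q"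
      using x[unfolded j] by (rule relpowp_Suc_E2)
    obtain R1 where Y1: "y_cover y P R1" "(y_cover y ^^ Suc j) R1 Q"
      using y[unfolded j] by (rule relpowp_Suc_E2)
    obtain R2 where Y2: "y_cover y R1 R2" "(y_cover y ^^ j) R2 Q" using Y1(2) by (rule relpowp_Suc_E2)
    obtain x1 x2 where E1: "E x1 y P R1" and E2: "E x2 y R1 R2" using Y1 Y2 unfolding y_cover_def by blast
    have "le R1 Q" "le R2 Q" using Y1 Y2 cover_carrier y_cover_cover y_chain_cover_pow cover_pow_le by blast+
    then have "x1 = x" using x_chain_first_label x E1 by blast
    then have "R1 = P1" using x_cover_deterministic X1 E1 unfolding x_cover_def by blast
    then have "x2 = x" using x_chain_first_label X1k E2 \<open>le R2 Q\<close> by blast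
    then show False using E1 E2 \<open>x1 = x\<close> E_no_repeat by blast
  qed
  then show ?thesis unfolding x_chains_def y_chains_def by auto
qed

lemma x_chain_ex_iff:
  assumes "P \<in> A" "x < n"
  shows "(\<exists>Q. (x_cover x ^^ k) P Q) \<longleftrightarrow> k \<le> run P ! x"
  using assms(1)
proof (induction k arbitrary: P)
  case (Suc k)
  show ?case
  proof
    assume "\<exists>Q. (x_cover x ^^ Suc k) P Q"
    then obtain Q where "(x_cover x ^^ Suc k) P Q" ..
    then obtain P1 where P1: "x_cover x P P1" "(x_cover x ^^ k) P1 Q" by (rule relpowp_Suc_E2)
    then have "P1 \<in> A" "run P ! x = Suc (run P1 ! x)" using E_carrier run_step unfolding x_cover_def by blast+
    then show "Suc k \<le> run P ! x" using Suc.IH P1 by auto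
  next
    assume "Suc k \<le> run P ! x"
    then obtain y P1 where E: "E x y P P1" using run_ex Suc.prems assms(2) by fastforce
    then have "P1 \<in> A" "k \<le> run P1 ! x"
      using E_carrier run_step[OF E] \<open>Suc k \<le> _\<close> by auto
    then obtain Q where "(x_cover x ^^ k) P1 Q" using Suc.IH by blast
    moreover have "x_cover x P P1" using E unfolding x_cover_def ..
    ultimately show "\<exists>Q. (x_cover x ^^ Suc k) P Q" using relpowp_Suc_I2[of "x_cover x"] by blast
  qed
qed auto

lemma x_chain_label_unique:
  assumes "(x_cover x ^^ k) P Q" "(x_cover x' ^^ k) P Q" "0 < k"
  shows "x = x'"
proof -
  obtain j where j: "k = Suc j" using assms(3) gr0_conv_Suc by blast
  obtain P1 where P1: "x_cover x P P1" "(x_cover x ^^ j) P1 Q" using assms(1)[unfolded j] by (rule relpowp_Suc_E2)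
  then have "le P1 Q" using x_chain_cover_pow cover_pow_le cover_carrier x_cover_cover by blast
  moreover obtain y where "E x y P P1" using P1(1) unfolding x_cover_def by blast
  ultimately show ?thesis using x_chain_first_label assms(2) by blast
qed

text \<open>A chain with constant first label is determined by its start and its label, but also by its two
  end points.\<close>

lemma card_x_chains:
  assumes "0 < k"
  shows "card (x_chains k) = card {(P, x). P \<in> A \<and> x < n \<and> k \<le> run P ! x}"
proof -
  let ?T = "{(P, x, Q). P \<in> A \<and> x < n \<and> (x_cover x ^^ k) P Q}"
  have x_chains: "x_chains k = (\<lambda>(P, x, Q). (P, Q)) ` ?T" unfolding x_chains_def by force
  have "inj_on (\<lambda>(P, x, Q). (P, Q)) ?T"
    using x_chain_label_unique assms by (auto simp: inj_on_def)
  then have *: "card (x_chains k) = card ?T" unfolding x_chains by (rule card_image)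
  have run: "{(P, x). P \<in> A \<and> x < n \<and> k \<le> run P ! x} = (\<lambda>(P, x, Q). (P, x)) ` ?T"
    using x_chain_ex_iff by (force simp: image_iff)
  have "inj_on (\<lambda>(P, x, Q). (P, x)) ?T"
    using x_chain_deterministic by (auto simp: inj_on_def)
  then show ?thesis unfolding * run by (rule card_image[symmetric])
qed

lemma finite_x_chains: "finite (x_chains k)"
  and finite_y_chains: "finite (y_chains k)"
proof -
  have "x_chains k \<subseteq> A \<times> A" "y_chains k \<subseteq> A \<times> A"
    using cover_pow_carrier x_chain_cover_pow y_chain_cover_pow unfolding x_chains_def y_chains_def by blast+
  moreover have "finite (A \<times> A)" using finite_carrier by simp
  ultimately show "finite (x_chains k)" "finite (y_chains k)" by (meson finite_subset)+
qed

lemma card_linear_intervals: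
  "card (linear_intervals A le k) =
    (if k = 0 then card A
     else (if k = 1 then 1 else 2) * card {(P, x). P \<in> A \<and> x < n \<and> k \<le> run P ! x})"
proof -
  consider "k = 0" | "k = 1" | "2 \<le> k" by linarith
  then show ?thesis
  proof cases
    case 1
    then show ?thesis using card_linear_intervals_0 by simp
  next
    case 2
    then show ?thesis using card_linear_intervals_pos[of 1] x_chains_1_eq_y_chains_1 card_x_chains[of 1] by simp
  next
    case 3
    then have "card (linear_intervals A le k) = card (x_chains k) + card (y_chains k)"
      using card_linear_intervals_pos x_chains_y_chains_disjoint finite_x_chains finite_y_chains by (simp add: card_Un_disjoint)
    then show ?thesis using 3 card_y_chains card_x_chains by simp
  qed
qed

end

section \<open>Rotations of binary trees\<close>

text \<open>Left rotations labelled by the inorder numbers, starting from 0, of the rotated node \<open>x\<close> and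
  of its right son \<open>y\<close>. A node has the size of its left subtree as its number within the subtree
  that it spans.\<close>

inductive rot :: "nat \<Rightarrow> nat \<Rightarrow> unit tree \<Rightarrow> unit tree \<Rightarrow> bool" where
  root: "rot (size B) (size B + 1 + size C)
    (Node B () (Node C () D)) (Node (Node B () C) () D)"
| left: "rot x y s t \<Longrightarrow> rot x y (Node s () r) (Node t () r)"
| right: "rot x y s t \<Longrightarrow>
    rot (size l + 1 + x) (size l + 1 + y) (Node l () s) (Node l () t)"

lemma rot_bounds: "rot x y P Q \<Longrightarrow> x < y \<and> y < size P \<and> size Q = size P"
  by (induction rule: rot.induct) auto

lemma rot_NodeE:
  assumes "rot x y (Node l u r) Q"
  obtains (root) C D where "r = Node C () D" "Q = Node (Node l () C) () D"
      "x = size l" "y = size l + 1 + size C"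
  | (left) l' where "Q = Node l' () r" "rot x y l l'" "x < y" "y < size l" "size l' = size l"
  | (right) r' x' y' where "Q = Node l () r'" "rot x' y' r r'" "x = size l + 1 + x'"
      "y = size l + 1 + y'" "x' < y'" "y' < size r" "size r' = size r"
  using assms
proof (cases rule: rot.cases)
  case (root C D)
  then show ?thesis using that(1) by simp
next
  case (left l')
  then show ?thesis using that(2) rot_bounds[OF left(3)] by simp
next
  case (right x' y' r')
  then show ?thesis using that(3) rot_bounds[OF right(5)] by simp
qed

lemma left_rotation_iff: "left_rotation P Q \<longleftrightarrow> (\<exists>x y. rot x y P Q)"
proof
  show "left_rotation P Q \<Longrightarrow> \<exists>x y. rot x y P Q"
    by (induction rule: left_rotation.induct) (blast intro: rot.intros)+
  have "rot x y P Q \<Longrightarrow> left_rotation P Q" for x y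
    by (induction rule: rot.induct) (auto intro: left_rotation.intros)
  then show "\<exists>x y. rot x y P Q \<Longrightarrow> left_rotation P Q" by blast
qed

lemma tamari_le_left: "tamari_le s t \<Longrightarrow> tamari_le (Node s () r) (Node t () r)"
  unfolding tamari_le_def
  by (induction rule: rtranclp_induct) (auto intro: left_rotation.left rtranclp.rtrancl_into_rtrancl)

lemma tamari_le_right: "tamari_le s t \<Longrightarrow> tamari_le (Node l () s) (Node l () t)"
  unfolding tamari_le_def
  by (induction rule: rtranclp_induct) (auto intro: left_rotation.right rtranclp.rtrancl_into_rtrancl)

lemma rot_tamari_le: "rot x y P Q \<Longrightarrow> tamari_le P Q"
  unfolding tamari_le_def using left_rotation_iff by blast

lemma tamari_le_trans: "tamari_le P Q \<Longrightarrow> tamari_le Q R \<Longrightarrow> tamari_le P R"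
  unfolding tamari_le_def by (rule rtranclp_trans)

text \<open>The sizes of the right subtrees of the nodes, listed in inorder. A rotation with labels \<open>x\<close>
  and \<open>y\<close> shrinks the right subtree of \<open>x\<close> to the nodes strictly between \<open>x\<close> and \<open>y\<close>, and
  changes no other entry.\<close>

fun right_sizes :: "unit tree \<Rightarrow> nat list" where
  "right_sizes Leaf = []"
| "right_sizes (Node l _ r) = right_sizes l @ size r # right_sizes r"

lemma length_right_sizes [simp]: "length (right_sizes t) = size t"
  by (induction t) auto

lemma rot_right_sizes:
  "rot x y P Q \<Longrightarrow> right_sizes Q = (right_sizes P)[x := y - x - 1] \<and> y \<le> x + right_sizes P ! x"
  by (induction rule: rot.induct)
    (auto simp: list_update_append nth_append dest: rot_bounds)

text \<open>The number of nodes on the leftmost branch.\<close>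

fun left_branch :: "unit tree \<Rightarrow> nat" where
  "left_branch Leaf = 0"
| "left_branch (Node l _ r) = Suc (left_branch l)"

text \<open>The lengths of the leftmost branches of the right subtrees of the nodes, in inorder. A rotation
  at \<open>x\<close> removes the topmost node of the branch belonging to \<open>x\<close>.\<close>

fun right_left_branches :: "unit tree \<Rightarrow> nat list" where
  "right_left_branches Leaf = []"
| "right_left_branches (Node l _ r) =
    right_left_branches l @ left_branch r # right_left_branches r"

lemma length_right_left_branches [simp]: "length (right_left_branches t) = size t"
  by (induction t) auto

lemma rot_run:
  "rot x y P Q \<Longrightarrow> right_left_branches P ! x = Suc (right_left_branches Q ! x)"
  by (induction rule: rot.induct) (auto simp: nth_append dest: rot_bounds)

lemma rot_run_ex:
  "x < size P \<Longrightarrow> 0 < right_left_branches P ! x \<Longrightarrow> \<exists>y Q. rot x y P Q"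
proof (induction P arbitrary: x)
  case (Node l u r)
  consider "x < size l" | "x = size l" | x' where "x = size l + 1 + x'"
    by (metis Suc_eq_plus1 add_Suc less_imp_Suc_add linorder_neqE_nat add.commute)
  then show ?case
  proof cases
    case 1
    then have "\<exists>y Q. rot x y l Q" using Node.IH(1) Node.prems by (simp add: nth_append)
    then obtain y Q where "rot x y l Q" by blast
    then show ?thesis using rot.left[of x y l Q r] by auto
  next
    case 2
    then obtain C D where "r = Node C () D" using Node by (cases r) (auto simp: nth_append)
    then show ?thesis using 2 rot.root[of l C D] by auto
  next
    case 3
    then have "\<exists>y Q. rot x' y r Q" using Node.IH(2) Node.prems by (simp add: nth_append)
    then obtain y Q where "rot x' y r Q" by blast
    then show ?thesis using 3 rot.right[of x' y r Q l] by auto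
  qed
qed simp

lemma rot_deterministic: "rot x y P Q \<Longrightarrow> rot x y' P Q' \<Longrightarrow> Q' = Q"
proof (induction arbitrary: y' Q' rule: rot.induct)
  case (root B C D)
  then show ?case by (elim rot_NodeE) auto
next
  case (left x y s t r)
  from left.prems rot_bounds[OF left.hyps] left.IH show ?case by (elim rot_NodeE) auto
next
  case (right x y s t l)
  from right.prems rot_bounds[OF right.hyps] right.IH show ?case by (elim rot_NodeE) auto
qed

lemma rot_mirror:
  "rot x y P Q \<Longrightarrow> rot (size P - 1 - y) (size P - 1 - x) (mirror Q) (mirror P)"
proof (induction rule: rot.induct)
  case (root B C D)
  show ?case using rot.root[of "mirror D" "mirror C" "mirror B"] by (simp add: algebra_simps)
next
  case (left x y s t r)
  have e: "size (mirror r) + 1 + (size s - 1 - y) = size (Node s () r) - 1 - y"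
    "size (mirror r) + 1 + (size s - 1 - x) = size (Node s () r) - 1 - x"
    using rot_bounds[OF left.hyps] by auto
  show ?case using rot.right[OF left.IH, of "mirror r"] unfolding e by simp
next
  case (right x y s t l)
  then show ?case using rot.left[OF right.IH, of "mirror l"] by simp
qed

text \<open>Most pairs of rotations with different labels commute, and the second move out of \<open>P\<close> is the
  second rotation done first. The exception is the short side of a pentagon,
  \<open>(B, (C, (D1, D2))) \<rightarrow> ((B, C), (D1, D2)) \<rightarrow> (((B, C), D1), D2)\<close>, whose long side begins with
  \<open>(B, ((C, D1), D2))\<close>.\<close>

lemma rot_both_change:
  "rot x y P Q \<Longrightarrow> rot x' y' Q R \<Longrightarrow> x \<noteq> x' \<Longrightarrow> y \<noteq> y' \<Longrightarrow>
    \<exists>z w P'. rot z w P P' \<and> z \<noteq> x \<and> tamari_le P' R"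
proof (induction arbitrary: x' y' R rule: rot.induct)
  case (root B C D)
  from root.prems(1) show ?case
  proof (cases rule: rot_NodeE)
    case (root D1 D2)
    \<comment> \<open>The pentagon: \<open>?P'\<close> starts its long side.\<close>
    let ?P' = "Node B () (Node (Node C () D1) () D2)"
    have first: "rot (size B + 1 + size C) (size B + 1 + (size C + 1 + size D1))
        (Node B () (Node C () D)) ?P'"
      unfolding root(1) by (intro rot.right rot.root)
    have "rot (size B) (size B + 1 + size (Node C () D1)) ?P'
        (Node (Node B () (Node C () D1)) () D2)" by (rule rot.root)
    moreover have "rot (size B) (size B + 1 + size C)
        (Node (Node B () (Node C () D1)) () D2) R"
      unfolding root(2) by (intro rot.left rot.root)
    ultimately have "tamari_le ?P' R" using rot_tamari_le tamari_le_trans by blast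
    moreover have "size B + 1 + size C \<noteq> size B" by simp
    ultimately show ?thesis using first by blast
  next
    case (left l')
    from left(2) show ?thesis
    proof (cases rule: rot_NodeE)
      case (root C1 C2)
      then show ?thesis using root.prems by simp
    next
      case l: (left B')
      have "rot x' y' (Node B () (Node C () D)) (Node B' () (Node C () D))"
        using l by (intro rot.left)
      moreover have "tamari_le (Node B' () (Node C () D)) R"
        using rot.root[of B' C D] rot_tamari_le l left by simp
      moreover have "x' \<noteq> size B" using l by simp
      ultimately show ?thesis by blast
    next
      case r: (right C' a b)
      have "rot (size B + 1 + a) (size B + 1 + b) (Node B () (Node C () D)) (Node B () (Node C' () D))"
        using r by (intro rot.right rot.left)
      moreover have "tamari_le (Node B () (Node C' () D)) R"
        using rot.root[of B C' D] rot_tamari_le r left by simp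
      moreover have "size B + 1 + a \<noteq> size B" by simp
      ultimately show ?thesis by blast
    qed
  next
    case (right D' a b)
    have "rot (size B + 1 + (size C + 1 + a)) (size B + 1 + (size C + 1 + b))
        (Node B () (Node C () D)) (Node B () (Node C () D'))"
      using right by (intro rot.right)
    moreover have "tamari_le (Node B () (Node C () D')) R"
      using rot.root[of B C D'] rot_tamari_le right by simp
    moreover have "size B + 1 + (size C + 1 + a) \<noteq> size B" by simp
      ultimately show ?thesis by blast
  qed
next
  case (left x y s t r)
  note b = rot_bounds[OF left.hyps]
  from left.prems(1) show ?case
  proof (cases rule: rot_NodeE)
    case (root C D)
    have "rot (size s) (size s + 1 + size C) (Node s () r) (Node (Node s () C) () D)"
      unfolding root(1) by (rule rot.root)
    moreover have "tamari_le (Node (Node s () C) () D) R"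
      unfolding root(2) using left.hyps by (intro tamari_le_left rot_tamari_le) (rule rot.left)
    moreover have "size s \<noteq> x" using b by linarith
    ultimately show ?thesis by blast
  next
    case l: (left t')
    then obtain z w P' where "rot z w s P'" "z \<noteq> x" "tamari_le P' t'"
      using left.IH left.prems by blast
    then show ?thesis using l rot.left tamari_le_left by blast
  next
    case rr: (right r' a b)
    have "rot (size s + 1 + a) (size s + 1 + b) (Node s () r) (Node s () r')"
      using rr by (intro rot.right)
    moreover have "tamari_le (Node s () r') R"
      unfolding rr(1) using left.hyps by (intro tamari_le_left rot_tamari_le)
    moreover have "size s + 1 + a \<noteq> x" using b by linarith
    ultimately show ?thesis by blast
  qed
next
  case (right x y s t l)
  from right.prems(1) show ?case
  proof (cases rule: rot_NodeE)
    case (root C D)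
    from right.hyps[unfolded root(1)] show ?thesis
    proof (cases rule: rot.cases)
      case r: (root B1 C1)
      then show ?thesis using right.prems root by simp
    next
      case r: (left C0)
      have "rot (size l) (size l + 1 + size C0) (Node l () s) (Node (Node l () C0) () D)"
        unfolding r(1) by (rule rot.root)
      moreover have "tamari_le (Node (Node l () C0) () D) R"
        unfolding root(2) using r by (intro tamari_le_left tamari_le_right rot_tamari_le)
      moreover have "size l \<noteq> size l + 1 + x" by simp
      ultimately show ?thesis by blast
    next
      case r: (right a b D0)
      have "rot (size l) (size l + 1 + size C) (Node l () s) (Node (Node l () C) () D0)"
        unfolding r(3) by (rule rot.root)
      moreover have "tamari_le (Node (Node l () C) () D0) R"
        unfolding root(2) using r by (intro tamari_le_right rot_tamari_le)
      moreover have "size l \<noteq> size l + 1 + x" by simp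
      ultimately show ?thesis by blast
    qed
  next
    case ll: (left l')
    have "rot x' y' (Node l () s) (Node l' () s)" using ll by (intro rot.left)
    moreover have "tamari_le (Node l' () s) R"
      unfolding ll(1) using right.hyps by (intro tamari_le_right rot_tamari_le)
    moreover have "x' \<noteq> size l + 1 + x" using ll by linarith
    ultimately show ?thesis by blast
  next
    case r: (right t' a b)
    then obtain z w P' where "rot z w s P'" "z \<noteq> x" "tamari_le P' t'"
      using right.IH[of a b t'] right.prems by auto
    then have "rot (size l + 1 + z) (size l + 1 + w) (Node l () s) (Node l () P')"
      "size l + 1 + z \<noteq> size l + 1 + x" "tamari_le (Node l () P') R"
      using r rot.right tamari_le_right by auto
    then show ?thesis by blast
  qed
qed

lemma rot_root_not_y: "rot x y (Node l u r) Q \<Longrightarrow> y \<noteq> size l"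
  by (elim rot_NodeE) auto

lemma rot_leftD: "rot x y (Node l u r) Q \<Longrightarrow> y < size l \<Longrightarrow> \<exists>l'. rot x y l l'"
  by (elim rot_NodeE) auto

lemma rot_rightD:
  assumes "rot x (size l + 1 + y) (Node l u (Node C v D)) Q" "size C \<noteq> y"
  shows "\<exists>x' r'. rot x' y (Node C v D) r'"
  using assms(1)
proof (cases rule: rot_NodeE)
  case (right r' x' y')
  then show ?thesis by auto
qed (use assms(2) in auto)

text \<open>After two rotations with first label \<open>x\<close>, the node \<open>y'\<close> has become the left son of \<open>y\<close>, so
  that it is not a right son. For the induction it is also needed that \<open>y'\<close> is not the root.\<close>

lemma rot_x_then_not_y:
  "rot x y P Q \<Longrightarrow> rot x y' Q R \<Longrightarrow>
    (\<nexists>x' R'. rot x' y' R R') \<and> (\<exists>l r. R = Node l () r \<and> size l \<noteq> y')"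
proof (induction arbitrary: y' R rule: rot.induct)
  case (root B C D)
  from root.prems show ?case
  proof (cases rule: rot_NodeE)
    case (left l')
    from left(2) show ?thesis
    proof (cases rule: rot_NodeE)
      case (root C1 C2)
      have "\<not> rot x' y' R R'" for x' R'
      proof
        assume "rot x' y' R R'"
        then obtain l'' where "rot x' y' l' l''"
          using rot_leftD[of x' y' l' "()" D R'] left by auto
        then show False using rot_root_not_y root by fastforce
      qed
      then show ?thesis using left root by auto
    qed auto
  qed auto
next
  case (left x y s t r)
  note b = rot_bounds[OF left.hyps]
  from left.prems show ?case
  proof (cases rule: rot_NodeE)
    case l: (left t')
    have "\<not> rot x' y' R R'" for x' R'
      using left.IH[OF l(2)] rot_leftD[of x' y' t' "()" r R'] l by auto
    then show ?thesis using l by auto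
  qed (use b in auto)
next
  case (right x y s t l)
  from right.prems show ?case
  proof (cases rule: rot_NodeE)
    case r: (right t' a b)
    have "rot x b t t'" using r by simp
    note IH = right.IH[OF this]
    then obtain C D where t': "t' = Node C () D" "size C \<noteq> b" by blast
    have "\<not> rot x' y' R R'" for x' R'
      using IH rot_rightD[of x' l b "()" C "()" D R'] r t' by auto
    then show ?thesis using r by auto
  qed auto
qed

text \<open>This happens on the long side of a pentagon,
  \<open>(E, (D, (C, B))) \<rightarrow> (E, ((D, C), B)) \<rightarrow> ((E, (D, C)), B) \<rightarrow> (((E, D), C), B)\<close>; the second move
  out of its bottom element leads to the short side, to \<open>((E, D), (C, B))\<close>.\<close>

lemma rot_y_then_x:
  "rot x y P Q \<Longrightarrow> rot x' y Q R \<Longrightarrow> rot x' y' R R' \<Longrightarrow>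
    \<exists>z w P'. rot z w P P' \<and> z \<noteq> x \<and> tamari_le P' R'"
proof (induction arbitrary: x' y' R R' rule: rot.induct)
  case (root B C D)
  from rot_root_not_y[OF root.prems(1)] show ?case by simp
next
  case (left x y s t r)
  note b = rot_bounds[OF left.hyps]
  from left.prems(1) show ?case
  proof (cases rule: rot_NodeE)
    case l: (left t')
    from left.prems(2)[unfolded l(1)] show ?thesis
    proof (cases rule: rot_NodeE)
      case ll: (left t'')
      obtain z w P' where "rot z w s P'" "z \<noteq> x" "tamari_le P' t''"
        using left.IH[OF l(2) ll(2)] by blast
      then show ?thesis using ll rot.left tamari_le_left by blast
    qed (use l in auto)
  qed (use b in auto)
next
  case (right x y s t l)
  from right.prems(1) show ?case
  proof (cases rule: rot_NodeE)
    case r: (root C D)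
    from right.hyps[unfolded r(1)] show ?thesis
    proof (cases rule: rot.cases)
      case s: (root E F)
      have R: "R = Node (Node l () (Node E () F)) () D" "x' = size l" using r s by auto
      have "R' = Node (Node (Node l () E) () F) () D"
        using right.prems(2)[unfolded R]
      proof (cases rule: rot_NodeE)
        case (left l')
        from left(2) have "l' = Node (Node l () E) () F"
          by (cases rule: rot_NodeE) auto
        then show ?thesis using left by simp
      qed auto
      then have "tamari_le (Node (Node l () E) () (Node F () D)) R'"
        using rot.root rot_tamari_le by metis
      moreover have "rot (size l) (size l + 1 + size E) (Node l () s)
          (Node (Node l () E) () (Node F () D))"
        unfolding s by (rule rot.root)
      moreover have "size l \<noteq> size l + 1 + x" by simp
      ultimately show ?thesis by blast
    qed (use r in \<open>auto dest: rot_bounds\<close>)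
  next
    case rr: (right t' a b)
    from right.prems(2)[unfolded rr(1)] show ?thesis
    proof (cases rule: rot_NodeE)
      case q: (right t'' a' b')
      obtain z w P' where "rot z w s P'" "z \<noteq> x" "tamari_le P' t''"
        using right.IH[of a t' b' t''] rr q by auto
      then have "rot (size l + 1 + z) (size l + 1 + w) (Node l () s) (Node l () P')"
        "size l + 1 + z \<noteq> size l + 1 + x" "tamari_le (Node l () P') R'"
        using q rot.right tamari_le_right by auto
      then show ?thesis by blast
    qed (use rr in auto)
  qed auto
qed

section \<open>Valley moves on Dyck paths\<close>

text \<open>The replacement of a valley by a peak, labelled by the indices, starting from 0, of the two
  letters among the down steps and among the up steps.\<close>

definition swap :: "nat \<Rightarrow> nat \<Rightarrow> step list \<Rightarrow> step list \<Rightarrow> bool" where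
  "swap x y v w \<longleftrightarrow> (\<exists>a b. v = a @ Down # Up # b \<and> w = a @ Up # Down # b \<and>
     x = count_list a Down \<and> y = count_list a Up)"

text \<open>A position carrying the letter \<open>c\<close> is determined by the number of letters \<open>c\<close> before it.\<close>

lemma prefix_before_unique:
  "a @ c # b = a' @ c # b' \<Longrightarrow> count_list a c = count_list a' c \<Longrightarrow> a = a' \<and> b = b'"
proof (induction a arbitrary: a')
  case Nil
  then show ?case by (cases a') auto
next
  case (Cons e a)
  then show ?case by (cases a') (auto split: if_splits)
qed

text \<open>For each down step, the number of up steps anywhere after it. A move with first label \<open>x\<close>
  lowers the entry of the down step \<open>x\<close> by one and changes no other entry.\<close>

fun ups_after :: "step list \<Rightarrow> nat list" where
  "ups_after [] = []"
| "ups_after (Up # w) = ups_after w"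
| "ups_after (Down # w) = count_list w Up # ups_after w"

lemma ups_after_append:
  "ups_after (a @ b) = map (\<lambda>i. i + count_list b Up) (ups_after a) @ ups_after b"
  by (induction a rule: ups_after.induct) auto

lemma length_ups_after [simp]: "length (ups_after w) = count_list w Down"
  by (induction w rule: ups_after.induct) auto

lemma swap_ups_after:
  assumes "swap x y v w" 
  shows "ups_after v ! x = count_list v Up - y" "y < count_list v Up"
   "ups_after w = (ups_after v)[x := count_list v Up - y - 1]"
  using assms unfolding swap_def
  by (auto simp: ups_after_append list_update_append nth_append)

fun leading_ups :: "step list \<Rightarrow> nat" where
  "leading_ups [] = 0"
| "leading_ups (Up # w) = Suc (leading_ups w)"
| "leading_ups (Down # w) = 0"

text \<open>For each down step, the number of up steps immediately after it.\<close>

fun up_runs :: "step list \<Rightarrow> nat list" where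
  "up_runs [] = []"
| "up_runs (Up # w) = up_runs w"
| "up_runs (Down # w) = leading_ups w # up_runs w"

lemma up_runs_append_nth: "up_runs (a @ b) ! (count_list a Down + j) = up_runs b ! j"
  by (induction a rule: up_runs.induct) auto

lemma swap_run: "swap x y v w \<Longrightarrow> up_runs v ! x = Suc (up_runs w ! x)"
proof -
  assume "swap x y v w"
  then obtain a b where "v = a @ Down # Up # b" "w = a @ Up # Down # b" "x = count_list a Down"
    unfolding swap_def by blast
  then show ?thesis
    using up_runs_append_nth[of a "Down # Up # b" 0] up_runs_append_nth[of a "Up # Down # b" 0] by simp
qed

lemma swap_run_ex:
  "x < count_list v Down \<Longrightarrow> 0 < up_runs v ! x \<Longrightarrow> \<exists>y w. swap x y v w"
proof -
  have "x < count_list v Down \<Longrightarrow> 0 < up_runs v ! x \<Longrightarrow>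
     \<exists>a b. v = a @ Down # Up # b \<and> count_list a Down = x"
  proof (induction v arbitrary: x rule: up_runs.induct)
    case (2 w)
    then obtain a b where "w = a @ Down # Up # b \<and> count_list a Down = x" by fastforce
    then show ?case by (intro exI[of _ "Up # a"] exI[of _ b]) auto
  next
    case (3 w)
    show ?case
    proof (cases x)
      case 0
      then obtain b where "w = Up # b" using 3 by (cases w rule: leading_ups.cases) auto
      then show ?thesis using 0 by (intro exI[of _ "[]"] exI[of _ b]) auto
    next
      case (Suc x')
      then obtain a b where "w = a @ Down # Up # b \<and> count_list a Down = x'" using 3 by fastforce
      then show ?thesis using Suc by (intro exI[of _ "Down # a"] exI[of _ b]) auto
    qed
  qed simp
  then show "x < count_list v Down \<Longrightarrow> 0 < up_runs v ! x \<Longrightarrow> \<exists>y w. swap x y v w"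
    unfolding swap_def by blast
qed

lemma swap_deterministic: "swap x y v w \<Longrightarrow> swap x y' v w' \<Longrightarrow> w' = w"
  unfolding swap_def using prefix_before_unique by (metis list.inject)

lemma swap_count: "swap x y v w \<Longrightarrow> count_list w c = count_list v c \<and> length w = length v"
  unfolding swap_def by (cases c) auto

lemma count_length: "count_list w Up + count_list w Down = length w"
proof (induction w)
  case (Cons a w)
  then show ?case by (cases a) auto
qed simp

lemma swap_prefix: "swap x y v w \<Longrightarrow> count_list (take m v) Up \<le> count_list (take m w) Up"
proof -
  assume "swap x y v w"
  then obtain a b where "v = a @ Down # Up # b" "w = a @ Up # Down # b"
    unfolding swap_def by blast
  then show ?thesis by (simp add: take_Cons')
qed

text \<open>A description by up steps alone: a prefix of length \<open>m\<close> has at least as many letters \<open>u\<close> as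
  \<open>d\<close> if and only if at least half of its letters are \<open>u\<close>.\<close>

lemma Dyck_iff: "w \<in> Dyck n \<longleftrightarrow> count_list w Up = n \<and> length w = 2 * n \<and>
    (\<forall>m\<le>2 * n. m \<le> 2 * count_list (take m w) Up)"
proof -
  have "count_list (take m w) Down \<le> count_list (take m w) Up \<longleftrightarrow>
      m \<le> 2 * count_list (take m w) Up" if "m \<le> length w" for m
    using count_length[of "take m w"] that by auto
  moreover have "count_list w Up = n \<and> count_list w Down = n \<longleftrightarrow>
      count_list w Up = n \<and> length w = 2 * n"
    using count_length[of w] by auto
  ultimately show ?thesis unfolding Dyck_def by auto
qed

lemma swap_Dyck: "swap x y v w \<Longrightarrow> v \<in> Dyck n \<Longrightarrow> w \<in> Dyck n"
  unfolding Dyck_iff using swap_count[of x y v w] swap_prefix[of x y v w]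
  by (auto intro: order_trans[OF _ mult_le_mono2])

text \<open>The comparison of heights before each step covers all proper prefixes; the full words agree
  anyway.\<close>

lemma dyck_le_iff:
  assumes "v \<in> Dyck n" "w \<in> Dyck n"
  shows "dyck_le n v w \<longleftrightarrow> (\<forall>m. count_list (take m v) Up \<le> count_list (take m w) Up)"
proof -
  have h: "step_height u (Suc m) = 2 * int (count_list (take m u) Up) - int m"
    if "u \<in> Dyck n" "m < 2 * n" for u m
    using count_length[of "take m u"] that unfolding Dyck_iff step_height_def by auto
  have "dyck_le n v w \<longleftrightarrow> (\<forall>m<2 * n. count_list (take m v) Up \<le> count_list (take m w) Up)"
  proof -
    have "{1..2 * n} = Suc ` {..<2 * n}" by (simp add: image_Suc_lessThan)
    then show ?thesis using h assms unfolding dyck_le_def by auto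
  qed
  moreover have "count_list (take m v) Up \<le> count_list (take m w) Up" if "\<not> m < 2 * n" for m
    using that assms unfolding Dyck_iff by simp
  ultimately show ?thesis by blast
qed

definition swaps :: "step list \<Rightarrow> step list \<Rightarrow> bool" where
  "swaps = (\<lambda>v w. \<exists>x y. swap x y v w)\<^sup>*\<^sup>*"

lemma swap_Cons: "swap x y v w \<Longrightarrow> \<exists>x y. swap x y (c # v) (c # w)"
  unfolding swap_def by (metis append_Cons)

lemma swaps_Cons: "swaps v w \<Longrightarrow> swaps (c # v) (c # w)"
  unfolding swaps_def
proof (induction rule: rtranclp_induct)
  case (step v w)
  then show ?case using swap_Cons by (metis (mono_tags, lifting) rtranclp.rtrancl_into_rtrancl)
qed simp

lemma swaps_trans: "swaps u v \<Longrightarrow> swaps v w \<Longrightarrow> swaps u w"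
  unfolding swaps_def by (rule rtranclp_trans)

lemma swap_swaps: "swap x y v w \<Longrightarrow> swaps v w"
  unfolding swaps_def by blast

lemma swaps_bubble: "swaps (replicate j Down @ Up # w) (Up # replicate j Down @ w)"
proof (induction j)
  case 0
  then show ?case by (simp add: swaps_def)
next
  case (Suc j)
  have "swap 0 0 (Down # Up # replicate j Down @ w) (Up # Down # replicate j Down @ w)"
    unfolding swap_def by (intro exI[of _ "[]"] exI[of _ "replicate j Down @ w"]) simp
  then show ?case using swaps_trans[OF swaps_Cons[OF Suc] swap_swaps] by simp
qed

lemma first_Up: "0 < count_list w Up \<Longrightarrow> \<exists>j b. w = replicate j Down @ Up # b"
proof (induction w)
  case (Cons c w)
  show ?case
  proof (cases c)
    case Up
    then show ?thesis by (intro exI[of _ 0]) auto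
  next
    case Down
    then obtain j b where "w = replicate j Down @ Up # b" using Cons by auto
    then show ?thesis using Down by (intro exI[of _ "Suc j"]) auto
  qed
qed simp

text \<open>If the words begin with \<open>d\<close> and \<open>u\<close> respectively, the first \<open>u\<close> of the smaller word is moved to
  its front past the preceding letters \<open>d\<close>; the result is still below the larger word. This needs
  no positivity of the paths.\<close>

lemma swaps_if_prefix:
  "length v = length w \<Longrightarrow> count_list v Up = count_list w Up \<Longrightarrow>
    (\<And>m. count_list (take m v) Up \<le> count_list (take m w) Up) \<Longrightarrow> swaps v w"
proof (induction w arbitrary: v)
  case Nil
  then show ?case by (simp add: swaps_def)
next
  case (Cons c w)
  from Cons.prems(1) obtain c' v' where v: "v = c' # v'" by (cases v) auto
  have le: "count_list (take (Suc m) v) Up \<le> count_list (take (Suc m) (c # w)) Up" for m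
    using Cons.prems(3) .
  show ?case
  proof (cases "c = c'")
    case True
    have "swaps v' w"
    proof (rule Cons.IH)
      show "count_list (take m v') Up \<le> count_list (take m w) Up" for m
        using le[of m] v True by (auto split: if_splits)
    qed (use Cons.prems v True in \<open>auto split: if_splits\<close>)
    then show ?thesis using v True swaps_Cons by simp
  next
    case False
    have c: "c = Up" "c' = Down"
      using le[of 0] v False by (cases c; cases c'; simp)+
    have "0 < count_list v Up" using Cons.prems(2) c by simp
    then obtain j b where b: "v = replicate j Down @ Up # b" using first_Up by blast
    have "swaps (replicate j Down @ b) w"
    proof (rule Cons.IH)
      fix m
      have "count_list (take m (replicate j Down @ b)) Up \<le> count_list (take (Suc m) v) Up - 1"
        unfolding b by (cases "m - j") (auto simp: Suc_diff_le not_less_eq_eq take_Cons' min_def)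
      then show "count_list (take m (replicate j Down @ b)) Up \<le> count_list (take m w) Up"
        using le[of m] c by simp
    qed (use Cons.prems b c in auto)
    then show ?thesis using swaps_trans[OF swaps_bubble swaps_Cons] b c by blast
  qed
qed

lemma swaps_prefix:
  "swaps v w \<Longrightarrow> count_list (take m v) Up \<le> count_list (take m w) Up"
  unfolding swaps_def
  by (induction rule: rtranclp_induct) (auto dest: swap_prefix order_trans)

lemma dyck_le_swaps: "v \<in> Dyck n \<Longrightarrow> w \<in> Dyck n \<Longrightarrow> dyck_le n v w \<longleftrightarrow> swaps v w"
  using dyck_le_iff swaps_prefix swaps_if_prefix by (auto simp: Dyck_iff)

text \<open>The two moves happen at disjoint places, so they commute.\<close>

lemma swap_both_change:
  assumes "swap x y u v" "swap x' y' v w" "x \<noteq> x'" "y \<noteq> y'"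
  shows "\<exists>z t u'. swap z t u u' \<and> z \<noteq> x \<and> swaps u' w"
proof -
  obtain a b where u: "u = a @ Down # Up # b" and v: "v = a @ Up # Down # b"
    and xy: "x = count_list a Down" "y = count_list a Up" using assms(1) swap_def by auto
  obtain a' b' where v': "v = a' @ Down # Up # b'" and w: "w = a' @ Up # Down # b'"
    and xy': "x' = count_list a' Down" "y' = count_list a' Up" using assms(2) swap_def by auto
  from v v' have "a @ Up # Down # b = a' @ Down # Up # b'" by simp
  then consider (1) c where "a = a' @ c" "c @ Up # Down # b = Down # Up # b'"
    | (2) c where "a' = a @ c" "Up # Down # b = c @ Down # Up # b'"
    by (auto simp: append_eq_append_conv2)
  then show ?thesis
  proof cases
    case 1
    then obtain c' where c': "c = Down # c'" "c' @ Up # Down # b = Up # b'" by (cases c) auto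
    then have "c' \<noteq> []" using 1 xy xy' assms(4) by auto
    then obtain d where d: "c' = Up # d" "b' = d @ Up # Down # b" using c' by (cases c') auto
    let ?u' = "a' @ Up # Down # d @ Down # Up # b"
    have "swap x' y' u ?u'" unfolding swap_def u xy' using 1 c' d by auto
    moreover have "swap (count_list (a' @ Up # Down # d) Down) (count_list (a' @ Up # Down # d) Up) ?u' w"
      unfolding swap_def w by (rule exI[of _ "a' @ Up # Down # d"]) (auto simp: d)
    ultimately show ?thesis using assms(3) swap_swaps by metis
  next
    case 2
    then obtain c' where c': "c = Up # c'" "Down # b = c' @ Down # Up # b'" by (cases c) auto
    then have "c' \<noteq> []" using 2 xy xy' assms(3) by auto
    then obtain d where d: "c' = Down # d" "b = d @ Down # Up # b'" using c' by (cases c') auto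
    let ?u' = "a @ Down # Up # d @ Up # Down # b'"
    have "swap x' y' u ?u'" unfolding swap_def u xy' 
      by (rule exI[of _ "a @ Down # Up # d"]) (auto simp: 2 c' d)
    moreover have "swap x y ?u' w"
      unfolding swap_def w xy by (rule exI[of _ a]) (auto simp: 2 c' d)
    ultimately show ?thesis using assms(3) swap_swaps by metis
  qed
qed

lemma swap_no_repeat:
  assumes "swap x y u v"
  shows "\<not> swap x y v w"
proof
  assume "swap x y v w"
  then obtain a' b' where v': "v = a' @ Down # Up # b'" "x = count_list a' Down" "y = count_list a' Up"
    using swap_def by auto
  obtain a b where v: "v = a @ Up # Down # b" "x = count_list a Down" "y = count_list a Up"
    using assms swap_def by auto
  have "a @ Up # Down # b = (a' @ [Down]) @ Up # b'" using v v' by simp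
  then have "a = a' @ [Down]" using prefix_before_unique[of a Up "Down # b" "a' @ [Down]"] v v' by simp
  then show False using v v' by simp
qed

text \<open>After \<open>duu \<rightarrow> udu \<rightarrow> uud\<close>, the up step moved last is preceded by an up step.\<close>

lemma swap_x_then_not_y:
  assumes "swap x y u v" "swap x y' v w"
  shows "\<not> swap x' y' w w'"
proof
  assume "swap x' y' w w'"
  then obtain a'' b'' where w': "w = a'' @ Down # Up # b''" "y' = count_list a'' Up"
    using swap_def by auto
  obtain a b where v: "v = a @ Up # Down # b" "x = count_list a Down" using assms(1) swap_def by auto
  obtain a' b' where v': "v = a' @ Down # Up # b'" "x = count_list a' Down" 
    "y' = count_list a' Up" "w = a' @ Up # Down # b'" using assms(2) swap_def by auto
  have "(a @ [Up]) @ Down # b = a' @ Down # Up # b'" using v v' by simp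
  then have "a' = a @ [Up]" using prefix_before_unique[of "a @ [Up]" Down b a'] v v' by simp
  moreover have "(a'' @ [Down]) @ Up # b'' = a' @ Up # Down # b'" using v' w' by simp
  then have "a'' @ [Down] = a'" using prefix_before_unique[of "a'' @ [Down]" Up b'' a'] v' w' by simp
  ultimately show False by simp
qed

text \<open>After \<open>ddu \<rightarrow> dud \<rightarrow> udd\<close>, the down step moved last is followed by a down step.\<close>

lemma swap_y_then_not_x:
  assumes "swap x y u v" "swap x' y v w"
  shows "\<not> swap x' y' w w'"
proof
  assume "swap x' y' w w'"
  then obtain a'' b'' where w': "w = a'' @ Down # Up # b''" "x' = count_list a'' Down"
    using swap_def by auto
  obtain a b where v: "v = a @ Up # Down # b" "y = count_list a Up" using assms(1) swap_def by auto
  obtain a' b' where v': "v = a' @ Down # Up # b'" "x' = count_list a' Down" 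
    "y = count_list a' Up" "w = a' @ Up # Down # b'" using assms(2) swap_def by auto
  have "a @ Up # Down # b = (a' @ [Down]) @ Up # b'" using v v' by simp
  then have b': "Down # b = b'" using prefix_before_unique[of a Up "Down # b" "a' @ [Down]"] v v' by simp
  have "a'' @ Down # Up # b'' = (a' @ [Up]) @ Down # b'" using v' w' by simp
  then have "Up # b'' = b'" using prefix_before_unique[of a'' Down "Up # b''" "a' @ [Up]"] v' w' by simp
  with b' have "Down # b = Up # b''" by simp
  then show False by simp
qed

fun flip :: "step \<Rightarrow> step" where "flip Up = Down" | "flip Down = Up"

text \<open>The reflection of a path in a vertical axis: the word is reversed and up and down steps are
  exchanged. Unlike the mirror image of trees, it preserves the order.\<close>

definition reflect :: "step list \<Rightarrow> step list" where "reflect w = rev (map flip w)"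

lemma flip_flip [simp]: "flip (flip c) = c" by (cases c) auto

lemma reflect_reflect [simp]: "reflect (reflect w) = w"
  unfolding reflect_def by (simp add: rev_map comp_def)

lemma count_map_flip: "count_list (map flip w) Up = count_list w Down"
    "count_list (map flip w) Down = count_list w Up"
proof (induction w)
  case (Cons c w)
  case 1
  then show ?case using Cons by (cases c) auto
  case 2
  then show ?case using Cons by (cases c) auto
qed simp_all

lemma count_reflect [simp]: "count_list (reflect w) Up = count_list w Down"
    "count_list (reflect w) Down = count_list w Up" "length (reflect w) = length w"
  unfolding reflect_def by (simp_all add: count_map_flip)

lemma reflect_append: "reflect (a @ b) = reflect b @ reflect a"
  unfolding reflect_def by simp

lemma reflect_Dyck: "w \<in> Dyck n \<Longrightarrow> reflect w \<in> Dyck n"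
proof -
  assume w: "w \<in> Dyck n"
  have "count_list (take m (reflect w)) Down \<le> count_list (take m (reflect w)) Up"
    if m: "m \<le> length w" for m
  proof -
    define a b where "a = take (length w - m) w" and "b = drop (length w - m) w"
    have ab: "w = a @ b" "length b = m" using m by (auto simp: a_def b_def)
    then have "take m (reflect w) = reflect b" by (simp add: reflect_append)
    moreover have "count_list a Down \<le> count_list a Up"
      using w unfolding a_def Dyck_def by auto
    moreover have "count_list a Down + count_list b Down = count_list a Up + count_list b Up"
      using w ab unfolding Dyck_def by auto
    ultimately show ?thesis by simp
  qed
  then show ?thesis using w unfolding Dyck_def by auto
qed

lemma swap_reflect:
  assumes "swap x y v w" "v \<in> Dyck n"
  shows "swap (n - 1 - y) (n - 1 - x) (reflect v) (reflect w)"
proof -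
  obtain a b where ab: "v = a @ Down # Up # b" "w = a @ Up # Down # b"
     "x = count_list a Down" "y = count_list a Up" using assms(1) swap_def by auto
  have r: "reflect v = reflect b @ Down # Up # reflect a" "reflect w = reflect b @ Up # Down # reflect a"
    unfolding ab by (simp_all add: reflect_def)
  have "count_list v Up = n" "count_list v Down = n" using assms(2) by (simp_all add: Dyck_def)
  then have "n = count_list a Up + 1 + count_list b Up" "n = count_list a Down + 1 + count_list b Down"
    unfolding ab(1) by auto
  then show ?thesis unfolding swap_def r ab(3,4)
    by (intro exI[of _ "reflect b"] exI[of _ "reflect a"]) simp
qed

lemma finite_Dyck: "finite (Dyck n)"
proof -
  have "(UNIV :: step set) = {Up, Down}" using step.exhaust by blast
  then have "finite (UNIV :: step set)" using finite.simps by metis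
  from finite_lists_length_eq[OF this, of "2 * n"]
  have "finite {w :: step list. length w = 2 * n}" by simp
  then show ?thesis by (rule finite_subset[rotated]) (simp add: subset_eq Dyck_iff)
qed

section \<open>The bijection between trees and Dyck paths\<close>

text \<open>The path \<open>u l d r\<close> of the tree \<open>(l, r)\<close>. The down steps correspond to the nodes in inorder.\<close>

fun dyck_word :: "unit tree \<Rightarrow> step list" where
  "dyck_word Leaf = []"
| "dyck_word (Node l _ r) = Up # dyck_word l @ Down # dyck_word r"

lemma count_dyck_word [simp]: "count_list (dyck_word t) Up = size t" "count_list (dyck_word t) Down = size t"
  by (induction t) auto

lemma leading_ups_append: "leading_ups (dyck_word t @ Down # w) = left_branch t"
  by (induction t arbitrary: w) auto

lemma leading_ups_append2: "leading_ups w = 0 \<Longrightarrow> leading_ups (dyck_word t @ w) = left_branch t"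
  by (cases t) (auto simp: leading_ups_append)

text \<open>The up steps following the down step of a node are the initial ones of the path of its right
  subtree, which correspond to the nodes on its leftmost branch.\<close>

lemma up_runs_append: "leading_ups w = 0 \<Longrightarrow>
   up_runs (dyck_word t @ w) = right_left_branches t @ up_runs w"
  by (induction t arbitrary: w) (auto simp: leading_ups_append2)

lemma up_runs_dyck_word: "up_runs (dyck_word t) = right_left_branches t"
  using up_runs_append[of "[]" t] by simp

lemma take_dyck_word: "count_list (take m (dyck_word t)) Down \<le> count_list (take m (dyck_word t)) Up"
proof (induction t arbitrary: m)
  case (Node l u r)
  show ?case
  proof (cases m)
    case (Suc m')
    then show ?thesis using Node.IH(1)[of m'] Node.IH(2)[of "m' - length (dyck_word l) - 1"]
      by (cases "m' - length (dyck_word l)") auto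
  qed simp
qed simp

lemma dyck_word_Dyck: "size t = n \<Longrightarrow> dyck_word t \<in> Dyck n"
  using take_dyck_word by (auto simp: Dyck_def)

text \<open>The inverse of \<^const>\<open>dyck_word\<close>: the word is read from right to left with a stack of trees. A
  down step pushes a leaf and an up step joins the two topmost trees. The last equation leaves
  the stack unchanged if it has fewer than two trees, which does not happen on the words of
  interest. A tree on top of the stack is the result of reading its path and a further down step, so the
  words to be parsed are paths with a down step appended.\<close>

fun parse :: "step list \<Rightarrow> unit tree list" where
  "parse [] = []"
| "parse (Down # w) = Leaf # parse w"
| "parse (Up # w) = (case parse w of l # r # s \<Rightarrow> Node l () r # s | s \<Rightarrow> s)"

lemma parse_dyck_word: "parse (dyck_word t @ Down # w) = t # parse w"
  by (induction t arbitrary: w) auto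

lemma dyck_word_inj: "dyck_word s = dyck_word t \<Longrightarrow> s = t"
  by (metis parse_dyck_word list.inject)

text \<open>The length of the stack is the excess of down steps over up steps in the suffix read so far, so
  the assumption keeps the stack from running empty.\<close>

lemma parse_inverse:
  assumes "\<And>m. m < length w \<Longrightarrow> count_list (drop m w) Up < count_list (drop m w) Down"
  shows "concat (map (\<lambda>t. dyck_word t @ [Down]) (parse w)) = w \<and>
    length (parse w) + count_list w Up = count_list w Down"
  using assms
proof (induction w rule: parse.induct)
  case (2 w)
  have "count_list (drop m w) Up < count_list (drop m w) Down" if "m < length w" for m
    using 2(2)[of "Suc m"] that by simp
  then show ?case using 2(1) by auto
next
  case (3 w)
  have "count_list (drop m w) Up < count_list (drop m w) Down" if "m < length w" for m
    using 3(2)[of "Suc m"] that by simp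
  then have IH: "concat (map (\<lambda>t. dyck_word t @ [Down]) (parse w)) = w"
    "length (parse w) + count_list w Up = count_list w Down" using 3(1) by auto
  moreover have "Suc (count_list w Up) < count_list w Down" using 3(2)[of 0] by simp
  ultimately have "2 \<le> length (parse w)" by linarith
  then obtain l r s where "parse w = l # r # s"
    by (metis Suc_le_length_iff numeral_2_eq_2)
  then show ?case using IH by auto
qed simp

lemma dyck_word_surj:
  assumes "w \<in> Dyck n" shows "\<exists>t. size t = n \<and> dyck_word t = w"
proof -
  have "count_list (drop m (w @ [Down])) Up < count_list (drop m (w @ [Down])) Down"
    if "m < length (w @ [Down])" for m
  proof -
    have "count_list (take m w) Up + count_list (drop m w) Up =
      count_list (take m w) Down + count_list (drop m w) Down"
      using assms unfolding Dyck_def by (metis (mono_tags, lifting) append_take_drop_id count_list_append mem_Collect_eq)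
    moreover have "count_list (take m w) Down \<le> count_list (take m w) Up"
      using assms that unfolding Dyck_def by auto
    ultimately show ?thesis using that by simp
  qed
  note p = parse_inverse[OF this]
  have "length (parse (w @ [Down])) = 1" using p assms unfolding Dyck_def by simp
  then obtain t where "parse (w @ [Down]) = [t]" by (cases "parse (w @ [Down])") auto
  then have "dyck_word t = w" using p by simp
  then show ?thesis using assms unfolding Dyck_def by (metis (mono_tags, lifting) count_dyck_word(1) mem_Collect_eq)
qed

lemma bij_dyck_word: "bij_betw dyck_word (Tam n) (Dyck n)"
  unfolding bij_betw_def Tam_def
  using dyck_word_inj dyck_word_Dyck dyck_word_surj by (auto simp: inj_on_def image_iff) metis

lemma finite_Tam: "finite (Tam n)"
  using bij_dyck_word finite_Dyck bij_betw_finite by blast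

section \<open>Counting linear intervals in both lattices\<close>

lemma tamari_labelled:
  "labelled_covers (Tam n) n tamari_le (\<lambda>x y P Q. P \<in> Tam n \<and> rot x y P Q)
    right_sizes right_left_branches mirror True"
proof
  have star: "(\<lambda>P Q. \<exists>x y. P \<in> Tam n \<and> rot x y P Q)\<^sup>*\<^sup>* P Q" if "tamari_le P Q" "P \<in> Tam n" for P Q
  proof -
    from that have "(\<lambda>P Q. \<exists>x y. P \<in> Tam n \<and> rot x y P Q)\<^sup>*\<^sup>* P Q \<and> Q \<in> Tam n"
      unfolding tamari_le_def
    proof (induction rule: rtranclp_induct)
      case (step Q R)
      then obtain x y where "rot x y Q R" using left_rotation_iff by blast
      moreover from this have "R \<in> Tam n" using step rot_bounds unfolding Tam_def by force
      ultimately show ?case using step by (auto intro: rtranclp.rtrancl_into_rtrancl)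
    qed simp
    then show ?thesis by blast
  qed
  show "tamari_le P Q \<longleftrightarrow> (\<lambda>P Q. \<exists>x y. P \<in> Tam n \<and> rot x y P Q)\<^sup>*\<^sup>* P Q"
    if "P \<in> Tam n" "Q \<in> Tam n" for P Q
  proof
    assume "(\<lambda>P Q. \<exists>x y. P \<in> Tam n \<and> rot x y P Q)\<^sup>*\<^sup>* P Q"
    then show "tamari_le P Q" unfolding tamari_le_def
      by (rule rtranclp_mono[THEN predicate2D, rotated]) (use left_rotation_iff in blast)
  qed (use star that in blast)
  show "\<exists>z w P'. (P \<in> Tam n \<and> rot z w P P') \<and> z \<noteq> x \<and> tamari_le P' R"
    if "P \<in> Tam n \<and> rot x y P Q" "Q \<in> Tam n \<and> rot x' y' Q R" "x \<noteq> x'" "y \<noteq> y'" for x y x' y' P Q R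
    using rot_both_change that by blast
  show "\<exists>z w P'. (P \<in> Tam n \<and> rot z w P P') \<and> z \<noteq> x \<and> tamari_le P' R'"
    if "P \<in> Tam n \<and> rot x y P Q" "Q \<in> Tam n \<and> rot x' y Q R" "R \<in> Tam n \<and> rot x' y' R R'" 
    for x y x' y' P Q R R'
    using rot_y_then_x that by blast
  show "finite (Tam n)" by (rule finite_Tam)
  show "P \<in> Tam n \<and> Q \<in> Tam n \<and> x < n \<and> y < n" if "P \<in> Tam n \<and> rot x y P Q" for x y P Q
    using that rot_bounds[of x y P Q] unfolding Tam_def by auto
  show "right_sizes Q ! x < right_sizes P ! x" if "P \<in> Tam n \<and> rot x y P Q" for x y P Q
    using that rot_right_sizes[of x y P Q] rot_bounds[of x y P Q] by auto
  show "right_sizes Q ! z = right_sizes P ! z" if "P \<in> Tam n \<and> rot x y P Q" "z \<noteq> x" for x y P Q z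
    using that rot_right_sizes[of x y P Q] by auto
  show "Q' = Q" if "P \<in> Tam n \<and> rot x y P Q" "P \<in> Tam n \<and> rot x y' P Q'" for x y P Q y' Q'
    using that rot_deterministic by blast
  show "\<not> (Q \<in> Tam n \<and> rot x y Q R)" if "P \<in> Tam n \<and> rot x y P Q" for x y P Q R
    using that rot_right_sizes[of x y P Q] rot_right_sizes[of x y Q R] rot_bounds[of x y P Q] by auto
  show "right_left_branches P ! x = Suc (right_left_branches Q ! x)" if "P \<in> Tam n \<and> rot x y P Q" for x y P Q
    using that rot_run by blast
  show "\<exists>y Q. P \<in> Tam n \<and> rot x y P Q" if "P \<in> Tam n" "x < n" "0 < right_left_branches P ! x" for P x
    using that rot_run_ex unfolding Tam_def by auto
  show "mirror P \<in> Tam n" if "P \<in> Tam n" for P using that unfolding Tam_def by simp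
  show "mirror (mirror P) = P" for P :: "unit tree" by simp
  show "if True then mirror Q \<in> Tam n \<and> rot (n - 1 - y) (n - 1 - x) (mirror Q) (mirror P)
    else mirror P \<in> Tam n \<and> rot (n - 1 - y) (n - 1 - x) (mirror P) (mirror Q)"
    if "P \<in> Tam n \<and> rot x y P Q" for x y P Q
    using that rot_mirror[of x y P Q] rot_bounds[of x y P Q] unfolding Tam_def by auto
  show False if "P \<in> Tam n \<and> rot x y P Q" "Q \<in> Tam n \<and> rot x y' Q R" "R \<in> Tam n \<and> rot x' y' R R'" 
    for x y x' y' P Q R R'
    using that rot_x_then_not_y by blast
qed

lemma dyck_labelled:
  "labelled_covers (Dyck n) n (dyck_le n) (\<lambda>x y v w. v \<in> Dyck n \<and> swap x y v w)
    ups_after up_runs reflect False"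
proof
  have "(\<lambda>v w. \<exists>x y. v \<in> Dyck n \<and> swap x y v w)\<^sup>*\<^sup>* v w" if "swaps v w" "v \<in> Dyck n" for v w
  proof -
    from that have "(\<lambda>v w. \<exists>x y. v \<in> Dyck n \<and> swap x y v w)\<^sup>*\<^sup>* v w \<and> w \<in> Dyck n"
      unfolding swaps_def
    proof (induction rule: rtranclp_induct)
      case (step u w)
      then show ?case using swap_Dyck
        by (metis (mono_tags, lifting) rtranclp.rtrancl_into_rtrancl)
    qed simp
    then show ?thesis by blast
  qed
  moreover have "swaps v w" if "(\<lambda>v w. \<exists>x y. v \<in> Dyck n \<and> swap x y v w)\<^sup>*\<^sup>* v w" for v w
    using that unfolding swaps_def by (rule rtranclp_mono[THEN predicate2D, rotated]) blast
  ultimately show "dyck_le n v w \<longleftrightarrow> (\<lambda>v w. \<exists>x y. v \<in> Dyck n \<and> swap x y v w)\<^sup>*\<^sup>* v w"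
    if "v \<in> Dyck n" "w \<in> Dyck n" for v w
    using dyck_le_swaps that by blast
  have swaps_Dyck: "swaps v w \<Longrightarrow> v \<in> Dyck n \<Longrightarrow> w \<in> Dyck n" for v w
    unfolding swaps_def by (induction rule: rtranclp_induct) (auto intro: swap_Dyck)
  show "\<exists>z t u'. (u \<in> Dyck n \<and> swap z t u u') \<and> z \<noteq> x \<and> dyck_le n u' w"
    if "u \<in> Dyck n \<and> swap x y u v" "v \<in> Dyck n \<and> swap x' y' v w" "x \<noteq> x'" "y \<noteq> y'" for x y x' y' u v w
    using swap_both_change[of x y u v x' y' w] that dyck_le_swaps swap_Dyck swaps_Dyck by metis
  show "\<exists>z t u'. (u \<in> Dyck n \<and> swap z t u u') \<and> z \<noteq> x \<and> dyck_le n u' w'"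
    if "u \<in> Dyck n \<and> swap x y u v" "v \<in> Dyck n \<and> swap x' y v w" "w \<in> Dyck n \<and> swap x' y' w w'" 
    for x y x' y' u v w w'
    using swap_y_then_not_x that by blast
  show "finite (Dyck n)" by (rule finite_Dyck)
  show "v \<in> Dyck n \<and> w \<in> Dyck n \<and> x < n \<and> y < n" if "v \<in> Dyck n \<and> swap x y v w" for x y v w
    using that swap_Dyck[of x y v w n] unfolding swap_def by (auto simp: Dyck_def)
  show "ups_after w ! x < ups_after v ! x" if "v \<in> Dyck n \<and> swap x y v w" for x y v w
    using that swap_ups_after[of x y v w] by (cases "x < length (ups_after v)") (auto simp: swap_def)
  show "ups_after w ! z = ups_after v ! z" if "v \<in> Dyck n \<and> swap x y v w" "z \<noteq> x" for x y v w z
    using that swap_ups_after[of x y v w] by auto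
  show "w' = w" if "v \<in> Dyck n \<and> swap x y v w" "v \<in> Dyck n \<and> swap x y' v w'" for x y v w y' w'
    using that swap_deterministic by blast
  show "\<not> (w \<in> Dyck n \<and> swap x y w u)" if "v \<in> Dyck n \<and> swap x y v w" for x y v w u
    using that swap_no_repeat by blast
  show "up_runs v ! x = Suc (up_runs w ! x)" if "v \<in> Dyck n \<and> swap x y v w" for x y v w
    using that swap_run by blast
  show "\<exists>y w. v \<in> Dyck n \<and> swap x y v w" if "v \<in> Dyck n" "x < n" "0 < up_runs v ! x" for v x
    using that swap_run_ex unfolding Dyck_def by auto
  show "reflect v \<in> Dyck n" if "v \<in> Dyck n" for v using that by (rule reflect_Dyck)
  show "reflect (reflect v) = v" for v by simp
  show "if False then reflect w \<in> Dyck n \<and> swap (n - 1 - y) (n - 1 - x) (reflect w) (reflect v)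
    else reflect v \<in> Dyck n \<and> swap (n - 1 - y) (n - 1 - x) (reflect v) (reflect w)"
    if "v \<in> Dyck n \<and> swap x y v w" for x y v w
    using that swap_reflect reflect_Dyck by simp
  show False if "u \<in> Dyck n \<and> swap x y u v" "v \<in> Dyck n \<and> swap x y' v w" "w \<in> Dyck n \<and> swap x' y' w w'" 
    for x y x' y' u v w w'
    using that swap_x_then_not_y by blast
qed

lemma card_runs:
  "card {(P, x). P \<in> Tam n \<and> x < n \<and> k \<le> right_left_branches P ! x} =
   card {(w, x). w \<in> Dyck n \<and> x < n \<and> k \<le> up_runs w ! x}"
proof -
  let ?f = "\<lambda>(P, x :: nat). (dyck_word P, x)"
  let ?T = "{(P, x). P \<in> Tam n \<and> x < n \<and> k \<le> right_left_branches P ! x}"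
  have "{(w, x). w \<in> Dyck n \<and> x < n \<and> k \<le> up_runs w ! x} = ?f ` ?T"
    unfolding bij_betw_imp_surj_on[OF bij_dyck_word, symmetric]
    by (force simp: up_runs_dyck_word image_iff)
  moreover have "inj_on ?f ?T" by (auto simp: inj_on_def dest: dyck_word_inj)
  ultimately show ?thesis by (simp add: card_image)
qed

theorem theorem3p3:
  fixes n k :: nat
  assumes "n \<ge> 1"
  shows "card (linear_intervals (Tam n) tamari_le k) =
         card (linear_intervals (Dyck n) (dyck_le n) k)"
  unfolding labelled_covers.card_linear_intervals[OF tamari_labelled]
    labelled_covers.card_linear_intervals[OF dyck_labelled]
  using card_runs bij_betw_same_card[OF bij_dyck_word] by simp

end
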